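(* Let $n$ be a positive integer and let $\mathfrak{S}_n$ be the symmetric group on $\{1,\ldots,n\}$. Then $\mathcal{Q}(\mathfrak{S}_n)$, the set of quandle isomorphism classes of generalized Alexander quandles $Q(\mathfrak{S}_n,\psi)$ with $\psi\in\mathrm{Aut}(\mathfrak{S}_n)$, is in one-to-one correspondence with the set of conjugacy classes of $\mathrm{Aut}(\mathfrak{S}_n)$, via $\psi\mapsto Q(\mathfrak{S}_n,\psi)$; that is, for $\psi,\psi'\in\mathrm{Aut}(\mathfrak{S}_n)$, the quandles $Q(\mathfrak{S}_n,\psi)$ and $Q(\mathfrak{S}_n,\psi')$ are isomorphic if and only if $\psi$ and $\psi'$ are conjugate in $\mathrm{Aut}(\mathfrak{S}_n)$.
   Context: For a finite group $G$ and a group automorphism $\psi\in\mathrm{Aut}(G)$, the generalized Alexander quandle $Q(G,\psi)$ is the set $G$ equipped with the maps $s_x:G\to G$, $s_x(y)=x\psi(x^{-1}y)$, for $x\in G$. A quandle isomorphism from $(Q,s)$ to $(Q',s')$ is a bijection $f:Q\to Q'$ with $f\circ s_x=s'_{f(x)}\circ f$ for all $x\in Q$. $\mathcal{Q}(G)=\{Q(G,\psi):\psi\in\mathrm{Aut}(G)\}/\cong$, where $\cong$ is quandle isomorphism. *)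

theory Defs
  imports "HOL-Algebra.Sym_Groups" "HOL-Algebra.Bij"
begin

text \<open>
  A quandle is given by its carrier \<open>Q\<close> and its family of maps \<open>s\<^sub>x : Q \<rightarrow> Q\<close>; \<open>qmap Q x y\<close> is \<open>s\<^sub>x(y)\<close>.
\<close>

record 'a quandle = "'a partial_object" +
  qmap :: "'a \<Rightarrow> 'a \<Rightarrow> 'a"

text \<open>
  The maps are made extensional, as the elements of \<^const>\<open>auto\<close> are, so that the record depends
  only on the values \<open>s\<^sub>x(y)\<close> with \<open>x\<close> and \<open>y\<close> in the group.
\<close>

definition gen_alexander_quandle :: "('a, 'b) monoid_scheme \<Rightarrow> ('a \<Rightarrow> 'a) \<Rightarrow> 'a quandle" where
  "gen_alexander_quandle G \<psi> =
     \<lparr>carrier = carrier G,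
      qmap = (\<lambda>x\<in>carrier G. \<lambda>y\<in>carrier G. x \<otimes>\<^bsub>G\<^esub> \<psi> (inv\<^bsub>G\<^esub> x \<otimes>\<^bsub>G\<^esub> y))\<rparr>"

definition quandle_iso :: "('a, 'c) quandle_scheme \<Rightarrow> ('b, 'd) quandle_scheme \<Rightarrow> ('a \<Rightarrow> 'b) set" where
  "quandle_iso Q Q' =
     {f. bij_betw f (carrier Q) (carrier Q') \<and>
         (\<forall>x\<in>carrier Q. \<forall>y\<in>carrier Q. f (qmap Q x y) = qmap Q' (f x) (f y))}"

definition quandle_isomorphic :: "('a, 'c) quandle_scheme \<Rightarrow> ('b, 'd) quandle_scheme \<Rightarrow> bool" where
  "quandle_isomorphic Q Q' \<longleftrightarrow> quandle_iso Q Q' \<noteq> {}"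

definition gen_alexander_quandles :: "('a, 'b) monoid_scheme \<Rightarrow> 'a quandle set" where
  "gen_alexander_quandles G = gen_alexander_quandle G ` carrier (AutoGroup G)"

definition gen_alexander_iso_rel :: "('a, 'b) monoid_scheme \<Rightarrow> 'a quandle rel" where
  "gen_alexander_iso_rel G =
     {(Q, Q'). Q \<in> gen_alexander_quandles G \<and> Q' \<in> gen_alexander_quandles G \<and>
               quandle_isomorphic Q Q'}"

definition gen_alexander_classes :: "('a, 'b) monoid_scheme \<Rightarrow> 'a quandle set set" where
  "gen_alexander_classes G = gen_alexander_quandles G // gen_alexander_iso_rel G"

definition conjugate_in :: "('a, 'b) monoid_scheme \<Rightarrow> 'a \<Rightarrow> 'a \<Rightarrow> bool" where
  "conjugate_in G a b \<longleftrightarrow> (\<exists>g\<in>carrier G. b = g \<otimes>\<^bsub>G\<^esub> a \<otimes>\<^bsub>G\<^esub> inv\<^bsub>G\<^esub> g)"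

definition conjugacy_rel :: "('a, 'b) monoid_scheme \<Rightarrow> 'a rel" where
  "conjugacy_rel G = {(a, b). a \<in> carrier G \<and> b \<in> carrier G \<and> conjugate_in G a b}"

definition conjugacy_classes :: "('a, 'b) monoid_scheme \<Rightarrow> 'a set set" where
  "conjugacy_classes G = carrier G // conjugacy_rel G"

lemma carrier_AutoGroup: "carrier (AutoGroup G) = auto G"
  by (simp add: AutoGroup_def)

lemma (in group) gen_alexander_qmap_closed:
  assumes "Q \<in> gen_alexander_quandles G" "x \<in> carrier Q" "y \<in> carrier Q"
  shows "qmap Q x y \<in> carrier Q"
proof -
  obtain \<psi> where \<psi>: "\<psi> \<in> hom G G" "Q = gen_alexander_quandle G \<psi>"
    using assms(1) by (auto simp: gen_alexander_quandles_def carrier_AutoGroup auto_def)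
  then show ?thesis
    using assms(2,3) by (simp add: gen_alexander_quandle_def hom_in_carrier)
qed

lemma (in group) equiv_gen_alexander_iso_rel:
  "equiv (gen_alexander_quandles G) (gen_alexander_iso_rel G)"
proof (rule equivI)
  show "gen_alexander_iso_rel G \<subseteq> gen_alexander_quandles G \<times> gen_alexander_quandles G"
    by (auto simp: gen_alexander_iso_rel_def)
  have "id \<in> quandle_iso Q Q" for Q :: "'a quandle"
    by (auto simp: quandle_iso_def)
  then show "refl_on (gen_alexander_quandles G) (gen_alexander_iso_rel G)"
    by (auto simp: refl_on_def gen_alexander_iso_rel_def quandle_isomorphic_def)
  show "sym (gen_alexander_iso_rel G)"
  proof (rule symI)
    fix Q Q' assume "(Q, Q') \<in> gen_alexander_iso_rel G"
    then obtain f where Q: "Q \<in> gen_alexander_quandles G" "Q' \<in> gen_alexander_quandles G"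
      and f: "f \<in> quandle_iso Q Q'"
      by (auto simp: gen_alexander_iso_rel_def quandle_isomorphic_def)
    let ?g = "inv_into (carrier Q) f"
    have bij: "bij_betw f (carrier Q) (carrier Q')" using f by (simp add: quandle_iso_def)
    have g: "bij_betw ?g (carrier Q') (carrier Q)" by (rule bij_betw_inv_into[OF bij])
    have "?g (qmap Q' x y) = qmap Q (?g x) (?g y)" if "x \<in> carrier Q'" "y \<in> carrier Q'" for x y
    proof -
      have c: "?g x \<in> carrier Q" "?g y \<in> carrier Q" using bij_betwE[OF g] that by simp_all
      have "f (qmap Q (?g x) (?g y)) = qmap Q' x y"
        using f c that bij by (simp add: quandle_iso_def bij_betw_inv_into_right)
      then show ?thesis
        using bij_betw_inv_into_left[OF bij gen_alexander_qmap_closed[OF Q(1) c]] by simp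
    qed
    then have "?g \<in> quandle_iso Q' Q" using g by (simp add: quandle_iso_def)
    then show "(Q', Q) \<in> gen_alexander_iso_rel G"
      using Q by (auto simp: gen_alexander_iso_rel_def quandle_isomorphic_def)
  qed
  show "trans (gen_alexander_iso_rel G)"
  proof (rule transI)
    fix P Q R assume "(P, Q) \<in> gen_alexander_iso_rel G" "(Q, R) \<in> gen_alexander_iso_rel G"
    then obtain f g where PR: "P \<in> gen_alexander_quandles G" "R \<in> gen_alexander_quandles G"
      and fg: "f \<in> quandle_iso P Q" "g \<in> quandle_iso Q R"
      by (auto simp: gen_alexander_iso_rel_def quandle_isomorphic_def)
    have "bij_betw (g \<circ> f) (carrier P) (carrier R)"
      using fg bij_betw_trans unfolding quandle_iso_def by blast
    moreover have "f x \<in> carrier Q" if "x \<in> carrier P" for x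
      using fg(1) that bij_betw_apply unfolding quandle_iso_def by fast
    ultimately have "g \<circ> f \<in> quandle_iso P R"
      using fg by (simp add: quandle_iso_def)
    then show "(P, R) \<in> gen_alexander_iso_rel G"
      using PR by (auto simp: gen_alexander_iso_rel_def quandle_isomorphic_def)
  qed
qed

lemma (in group) equiv_conjugacy_rel: "equiv (carrier G) (conjugacy_rel G)"
proof (rule equivI)
  show "conjugacy_rel G \<subseteq> carrier G \<times> carrier G" by (auto simp: conjugacy_rel_def)
  have "conjugate_in G a a" if "a \<in> carrier G" for a
    unfolding conjugate_in_def by (rule bexI[where x = \<one>]) (use that in simp_all)
  then show "refl_on (carrier G) (conjugacy_rel G)"
    by (simp add: refl_on_def conjugacy_rel_def)
  show "sym (conjugacy_rel G)"
  proof (rule symI)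
    fix a b assume "(a, b) \<in> conjugacy_rel G"
    then obtain g where g: "g \<in> carrier G" "a \<in> carrier G" "b \<in> carrier G" "b = g \<otimes> a \<otimes> inv g"
      unfolding conjugacy_rel_def conjugate_in_def by blast
    have "inv g \<otimes> b \<otimes> inv (inv g) = (inv g \<otimes> g) \<otimes> a \<otimes> (inv g \<otimes> g)"
      using g(1,2) by (simp only: g(4) m_assoc inv_inv inv_closed m_closed)
    then have "a = inv g \<otimes> b \<otimes> inv (inv g)" using g(1,2) by simp
    then have "conjugate_in G b a" unfolding conjugate_in_def using g(1) inv_closed by blast
    then show "(b, a) \<in> conjugacy_rel G" using g(2,3) by (simp add: conjugacy_rel_def)
  qed
  show "trans (conjugacy_rel G)"
  proof (rule transI)
    fix a b c assume "(a, b) \<in> conjugacy_rel G" "(b, c) \<in> conjugacy_rel G"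
    then obtain g h where g: "g \<in> carrier G" "h \<in> carrier G" "a \<in> carrier G" "c \<in> carrier G"
      "c = h \<otimes> (g \<otimes> a \<otimes> inv g) \<otimes> inv h"
      unfolding conjugacy_rel_def conjugate_in_def by blast
    have "c = (h \<otimes> g) \<otimes> a \<otimes> inv (h \<otimes> g)"
      using g(1-3) by (simp only: g(5) m_assoc inv_mult_group inv_closed m_closed)
    then have "conjugate_in G a c" unfolding conjugate_in_def using g(1,2) m_closed by blast
    then show "(a, c) \<in> conjugacy_rel G" using g(3,4) by (simp add: conjugacy_rel_def)
  qed
qed

end

theory Submission
  imports Defs
begin

text \<open>
Left multiplications of a group \<open>G\<close> are automorphisms of \<open>Q(G,\<psi>)\<close>, so an isomorphism \<open>Q(G,\<psi>) \<rightarrow> Q(G,\<psi>')\<close>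
may be assumed to be a bijection \<open>f\<close> of \<open>G\<close> with \<open>f(1) = 1\<close>. Since \<open>s\<^sub>1 = \<psi>\<close>, such an \<open>f\<close> satisfies
\<open>f \<circ> \<psi> = \<psi>' \<circ> f\<close>, and since \<open>s\<^sub>x \<circ> s\<^sub>1\<^sup>-\<^sup>1\<close> is left multiplication by \<open>x \<psi>(x)\<^sup>-\<^sup>1\<close>, it satisfies
\<open>f(p y) = f(p) f(y)\<close> for all \<open>p\<close> in the subgroup \<open>P\<close> generated by the elements \<open>x \<psi>(x)\<^sup>-\<^sup>1\<close>. This
displacement subgroup is normal, and \<open>f\<close> restricts to an isomorphism from \<open>P\<close> to the displacement
subgroup \<open>P'\<close> of \<open>\<psi>'\<close> (\<open>quandle_isomorphic_imp_pointed_iso\<close>).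

A nontrivial normal subgroup of \<open>S\<^sub>n\<close> contains \<open>A\<^sub>n\<close>, except that for \<open>n = 4\<close> it may be the Klein
four-group (\<open>alt_group_subset_normal_subgroup\<close>). This leaves the following cases.

 \<^item> If \<open>P\<close> is trivial, then both automorphisms are the identity.
 \<^item> If \<open>P\<close> is all of \<open>S\<^sub>n\<close>, then \<open>f\<close> is an automorphism that conjugates \<open>\<psi>\<close> to \<open>\<psi>'\<close>.
 \<^item> If \<open>P = P' = A\<^sub>n\<close> and \<open>n \<le> 3\<close>, then \<open>f\<close> is again an automorphism, because every odd permutation
   is an involution that inverts \<open>A\<^sub>n\<close>.
 \<^item> If \<open>P = P' = A\<^sub>n\<close> and \<open>n \<ge> 4\<close>, then \<open>f\<close> restricted to \<open>A\<^sub>n\<close> extends to an automorphism \<open>\<theta>\<close> of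
   \<open>S\<^sub>n\<close>. The homomorphisms \<open>\<theta> \<circ> \<psi>\<close> and \<open>\<psi>' \<circ> \<theta>\<close> agree on \<open>A\<^sub>n\<close>, hence everywhere, because only the
   identity of \<open>S\<^sub>n\<close> centralizes \<open>A\<^sub>n\<close>.
 \<^item> In the exceptional case for \<open>n = 4\<close>, both automorphisms are conjugations by fixed-point-free
   involutions, and those are conjugate to each other.

The main point is that every automorphism \<open>\<alpha>\<close> of \<open>A\<^sub>n\<close> extends to \<open>S\<^sub>n\<close> for \<open>n \<ge> 4\<close>
(\<open>alt_group_automorphism_extends\<close>). Write \<open>c\<^sub>x\<close> for conjugation by \<open>x\<close>. The claim follows if each
\<open>\<alpha> \<circ> c\<^sub>x \<circ> \<alpha>\<^sup>-\<^sup>1\<close> with \<open>x\<close> in \<open>S\<^sub>n\<close> is again of the form \<open>c\<^sub>g\<close>: then \<open>\<theta>(x) = g\<close> is the extension. An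
automorphism of \<open>A\<^sub>n\<close> that maps 3-cycles to 3-cycles is such a conjugation
(\<open>three_cycle_preserving_is_conjugation\<close>), so it suffices that \<open>\<alpha> \<circ> c\<^sub>x \<circ> \<alpha>\<^sup>-\<^sup>1\<close> preserves 3-cycles. For \<open>n = 4\<close>
the 3-cycles are exactly the elements of order three. For \<open>n \<ge> 5\<close> every element of order three commutes
with an odd permutation, so it is conjugate under \<open>A\<^sub>n\<close> to each of its conjugates under \<open>S\<^sub>n\<close>. If \<open>c\<close> is a
3-cycle, then \<open>x \<alpha>\<^sup>-\<^sup>1(c) x\<^sup>-\<^sup>1 = y \<alpha>\<^sup>-\<^sup>1(c) y\<^sup>-\<^sup>1\<close> for some \<open>y\<close> in \<open>A\<^sub>n\<close>, and \<open>\<alpha>\<close> maps this to the 3-cycle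
\<open>\<alpha>(y) c \<alpha>(y)\<^sup>-\<^sup>1\<close>. Nothing has to be known about \<open>\<alpha>\<^sup>-\<^sup>1(c)\<close> beyond its order, which is how the outer
automorphisms for \<open>n = 6\<close>, which exchange the two classes of elements of order three, are covered.
\<close>

section \<open>Three-cycles and the alternating group\<close>

text \<open>
The values are written out, instead of a product of two transpositions, so that simplification can
evaluate composites of 3-cycles pointwise; \<open>cyc a b c\<close> is a 3-cycle only for distinct \<open>a\<close>, \<open>b\<close>, \<open>c\<close>.
\<close>

definition cyc :: "'a \<Rightarrow> 'a \<Rightarrow> 'a \<Rightarrow> 'a \<Rightarrow> 'a" where
  "cyc a b c = (\<lambda>x. if x = a then b else if x = b then c else if x = c then a else x)"

definition three_cycle :: "'a set \<Rightarrow> ('a \<Rightarrow> 'a) \<Rightarrow> bool" where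
  "three_cycle S p \<longleftrightarrow> (\<exists>a b c. distinct [a, b, c] \<and> {a, b, c} \<subseteq> S \<and> p = cyc a b c)"

lemma cyc_apply:
  "cyc a b c a = b"
  "a \<noteq> b \<Longrightarrow> cyc a b c b = c"
  "a \<noteq> c \<Longrightarrow> b \<noteq> c \<Longrightarrow> cyc a b c c = a"
  "x \<noteq> a \<Longrightarrow> x \<noteq> b \<Longrightarrow> x \<noteq> c \<Longrightarrow> cyc a b c x = x"
  by (auto simp: cyc_def)

lemma cyc_eq_transpose_comp:
  "distinct [a, b, c] \<Longrightarrow> cyc a b c = transpose a b \<circ> transpose b c"
  by (auto simp: cyc_def transpose_def fun_eq_iff)

lemma cyc_rotate: "distinct [a, b, c] \<Longrightarrow> cyc a b c = cyc b c a"
  by (auto simp: cyc_def fun_eq_iff)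

lemma cyc_inverse: "distinct [a, b, c] \<Longrightarrow> cyc a b c \<circ> cyc b a c = id"
  by (auto simp: cyc_def fun_eq_iff)

lemma cyc_cube: "distinct [a, b, c] \<Longrightarrow> cyc a b c \<circ> cyc a b c \<circ> cyc a b c = id"
  by (auto simp: cyc_def fun_eq_iff)

lemma cyc_square: "distinct [a, b, c] \<Longrightarrow> cyc a b c \<circ> cyc a b c = cyc b a c"
  by (auto simp: cyc_def fun_eq_iff)

lemma cyc_neq_id: "distinct [a, b, c] \<Longrightarrow> cyc a b c \<noteq> id"
  by (auto simp: cyc_def fun_eq_iff)

lemma cyc_square_neq_id: "distinct [a, b, c] \<Longrightarrow> cyc a b c \<circ> cyc a b c \<noteq> id"
  using cyc_neq_id[of b a c] by (auto simp: cyc_square)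

lemma comp_cyc: "inj g \<Longrightarrow> g \<circ> cyc a b c = cyc (g a) (g b) (g c) \<circ> g"
  by (auto simp: cyc_def fun_eq_iff inj_eq)

lemma conj_cyc:
  assumes "g permutes S"
  shows "g \<circ> cyc a b c \<circ> inv' g = cyc (g a) (g b) (g c)"
  using comp_cyc[OF permutes_inj[OF assms], of a b c] permutes_inv_o(1)[OF assms]
  by (simp add: comp_assoc)

lemma cyc_permutes:
  assumes "distinct [a, b, c]" "{a, b, c} \<subseteq> S"
  shows "cyc a b c permutes S"
  using assms by (auto simp: cyc_eq_transpose_comp intro!: permutes_compose permutes_swap_id)

lemma evenperm_cyc:
  assumes "distinct [a, b, c]"
  shows "evenperm (cyc a b c)"
  using assms by (simp add: cyc_eq_transpose_comp evenperm_comp evenperm_swap permutation_swap_id)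

lemma cyc_in_alt_group:
  assumes "distinct [a, b, c]" "{a, b, c} \<subseteq> {1..n}"
  shows "cyc a b c \<in> carrier (alt_group n)"
  using cyc_permutes[OF assms] evenperm_cyc[OF assms(1)] by (simp add: alt_group_carrier)

lemma subgroup_comp_closed:
  "subgroup H (sym_group n) \<Longrightarrow> p \<in> H \<Longrightarrow> q \<in> H \<Longrightarrow> p \<circ> q \<in> H"
  using subgroup.m_closed[of H "sym_group n" p q] by (simp add: sym_group_mult)

lemma subgroup_permutes:
  "subgroup H (sym_group n) \<Longrightarrow> p \<in> H \<Longrightarrow> p permutes {1..n}"
  using subgroup.mem_carrier sym_group_carrier by metis

lemma subgroup_inv_closed:
  "subgroup H (sym_group n) \<Longrightarrow> p \<in> H \<Longrightarrow> inv' p \<in> H"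
  using subgroup.m_inv_closed[of H "sym_group n" p] subgroup.mem_carrier[of H "sym_group n" p] by simp

lemma alt_group_subset_if_cycs:
  assumes H: "subgroup H (sym_group n)"
    and cycs: "\<And>a b c. distinct [a, b, c] \<Longrightarrow> {a, b, c} \<subseteq> {1..n} \<Longrightarrow> cyc a b c \<in> H"
  shows "carrier (alt_group n) \<subseteq> H"
proof -
  interpret S: group "sym_group n" by (rule sym_group_is_group)
  have "three_cycles n \<subseteq> H"
  proof
    fix p assume "p \<in> three_cycles n"
    then obtain cs where cs: "p = cycle_of_list cs" "distinct cs" "length cs = 3" "set cs \<subseteq> {1..n}"
      by auto
    obtain a b c where "cs = [a, b, c]" using stupid_lemma[OF cs(3)] by blast
    then show "p \<in> H" using cs cycs[of a b c] by (simp add: cyc_eq_transpose_comp)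
  qed
  then have "generate (sym_group n) (three_cycles n) \<subseteq> H"
    by (rule S.generate_subgroup_incl[OF _ H])
  moreover have "generate (alt_group n) (three_cycles n) = generate (sym_group n) (three_cycles n)"
    using S.generate_consistent[OF three_cycles_incl alt_group_is_subgroup]
    by (simp add: alt_group_def)
  ultimately show ?thesis by (simp add: alt_group_carrier_as_three_cycles)
qed

text \<open>
The 3-cycles through the arc \<open>1 \<mapsto> 2\<close> generate the alternating group: conjugating them by each other and
by their inverses moves \<open>1\<close> and \<open>2\<close> to arbitrary points, one at a time.
\<close>

lemma alt_group_subset_if_cycs_12:
  assumes H: "subgroup H (sym_group n)"
    and cycs: "\<And>i. i \<in> {3..n} \<Longrightarrow> cyc 1 2 i \<in> H"
  shows "carrier (alt_group n) \<subseteq> H"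
proof (rule alt_group_subset_if_cycs[OF H])
  have conj: "cyc (s a) (s b) (s c) \<in> H" if "s \<in> H" "cyc a b c \<in> H" for s a b c
    using subgroup_comp_closed[OF H subgroup_comp_closed[OF H that] subgroup_inv_closed[OF H that(1)]]
    by (simp add: conj_cyc[OF subgroup_permutes[OF H that(1)]])
  have rot: "cyc b c a \<in> H" if "cyc a b c \<in> H" "distinct [a, b, c]" for a b c
    using that cyc_rotate by metis
  have inv: "cyc b a c \<in> H" if "cyc a b c \<in> H" "distinct [a, b, c]" for a b c
    using subgroup_comp_closed[OF H that(1,1)] that(2) by (simp add: cyc_square)
  have c21: "cyc 2 1 i \<in> H" if "i \<in> {3..n}" for i
    using inv[OF cycs[OF that]] that by simp
  have c2: "cyc 2 j i \<in> H" if "i \<in> {3..n}" "j \<in> {3..n}" "i \<noteq> j" for i j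
    using conj[OF cycs[OF that(2)] cycs[OF that(1)]] that by (simp add: cyc_apply)
  have c1: "cyc 1 i j \<in> H" if "i \<in> {3..n}" "j \<in> {3..n}" "i \<noteq> j" for i j
    using rot[OF conj[OF c21[OF that(2)] cycs[OF that(1)]]] that by (simp add: cyc_apply)
  have c0: "cyc k i j \<in> H" if "i \<in> {3..n}" "j \<in> {3..n}" "k \<in> {3..n}" "distinct [i, j, k]" for i j k
    using conj[OF c21[OF that(3)] c1[OF that(1,2)]] that by (simp add: cyc_apply)
  fix a b c assume d: "distinct [a, b, c]" and S: "{a, b, c} \<subseteq> {1..n}"
  have rot2: "cyc a b c \<in> H" if "cyc b c a \<in> H \<or> cyc c a b \<in> H"
    using that d rot[of b c a] rot[of c a b] rot[of a b c] by auto
  have "a = 1 \<or> a = 2 \<or> a \<in> {3..n}" "b = 1 \<or> b = 2 \<or> b \<in> {3..n}" "c = 1 \<or> c = 2 \<or> c \<in> {3..n}"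
    using S by auto
  moreover have ne: "a \<noteq> b" "b \<noteq> c" "a \<noteq> c"
    using d by auto
  moreover have c0': "cyc a b c \<in> H" if "a \<in> {3..n}" "b \<in> {3..n}" "c \<in> {3..n}"
    using c0[of b c a] that ne by simp
  ultimately have "cyc a b c \<in> H \<or> cyc b c a \<in> H \<or> cyc c a b \<in> H"
    by (elim disjE; hypsubst?; (blast intro: cycs c21 c1 c2 c0')?)
  then show "cyc a b c \<in> H" using rot2 by blast
qed

lemma commutator_transpose:
  assumes "\<sigma> permutes S"
  shows "transpose a b \<circ> \<sigma> \<circ> inv' (transpose a b) \<circ> inv' \<sigma> = transpose a b \<circ> transpose (\<sigma> a) (\<sigma> b)"
proof -
  have "\<sigma> \<circ> transpose a b = transpose (\<sigma> a) (\<sigma> b) \<circ> \<sigma>"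
    using permutes_inj[OF assms] by (auto simp: transpose_def fun_eq_iff inj_eq)
  then show ?thesis using permutes_inv_o(1)[OF assms] by (simp add: comp_assoc)
qed

text \<open>
The commutator of \<open>\<sigma>\<close> with a transposition \<open>(a b)\<close> is \<open>(a b)(\<sigma>a \<sigma>b)\<close>, which is a 3-cycle when the two
transpositions share exactly one point. Such \<open>a\<close> and \<open>b\<close> exist unless all cycles of \<open>\<sigma>\<close> have length two:
take \<open>b = \<sigma>a\<close> when \<open>a\<close> lies on a longer cycle, and a moved \<open>a\<close> with a fixed \<open>b\<close> when there is a fixed point.
\<close>

lemma three_cycle_commutator_or_fpf_involution:
  assumes \<sigma>: "\<sigma> permutes S" "\<sigma> \<noteq> id"
    and no_cyc: "\<And>t a b c. \<lbrakk>t permutes S; distinct [a, b, c]; {a, b, c} \<subseteq> S;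
        t \<circ> \<sigma> \<circ> inv' t \<circ> inv' \<sigma> = cyc a b c\<rbrakk> \<Longrightarrow> False"
  shows "\<forall>x\<in>S. \<sigma> x \<noteq> x" "\<forall>x. \<sigma> (\<sigma> x) = x"
proof -
  have inS: "x \<in> S" if "\<sigma> x \<noteq> x" for x using permutes_not_in[OF \<sigma>(1)] that by blast
  show inv: "\<forall>x. \<sigma> (\<sigma> x) = x"
  proof (rule ccontr)
    assume "\<not> (\<forall>x. \<sigma> (\<sigma> x) = x)"
    then obtain a where a: "\<sigma> (\<sigma> a) \<noteq> a" by blast
    have a': "\<sigma> a \<noteq> a" using a by metis
    then have "\<sigma> (\<sigma> a) \<noteq> \<sigma> a" by (simp add: inj_eq[OF permutes_inj[OF \<sigma>(1)]])
    then have d: "distinct [a, \<sigma> a, \<sigma> (\<sigma> a)]" using a a' by simp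
    then have S: "{a, \<sigma> a, \<sigma> (\<sigma> a)} \<subseteq> S" using inS[OF a'] by (simp add: permutes_in_image[OF \<sigma>(1)])
    have "transpose a (\<sigma> a) \<circ> \<sigma> \<circ> inv' (transpose a (\<sigma> a)) \<circ> inv' \<sigma> = cyc a (\<sigma> a) (\<sigma> (\<sigma> a))"
      by (simp only: commutator_transpose[OF \<sigma>(1)] cyc_eq_transpose_comp[OF d])
    then show False
      using no_cyc[OF _ d S] permutes_swap_id[of a S "\<sigma> a"] S by blast
  qed
  show "\<forall>x\<in>S. \<sigma> x \<noteq> x"
  proof
    fix c assume c: "c \<in> S"
    show "\<sigma> c \<noteq> c"
    proof
      assume fix_c: "\<sigma> c = c"
      obtain a where a: "\<sigma> a \<noteq> a" using \<sigma>(2) by (auto simp: fun_eq_iff)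
      then have d: "distinct [a, c, \<sigma> a]" using fix_c inv[rule_format, of a] by auto
      then have S: "{a, c, \<sigma> a} \<subseteq> S" using inS[OF a] c by (simp add: permutes_in_image[OF \<sigma>(1)])
      have "transpose a c \<circ> \<sigma> \<circ> inv' (transpose a c) \<circ> inv' \<sigma> = cyc a c (\<sigma> a)"
        by (simp only: commutator_transpose[OF \<sigma>(1)] cyc_eq_transpose_comp[OF d] fix_c
            transpose_commute[of "\<sigma> a" c])
      then show False
        using no_cyc[OF _ d S] permutes_swap_id[of a S c] S by blast
    qed
  qed
qed

section \<open>Normal subgroups, centralizers and elements of small order in symmetric groups\<close>

lemma permutes_conj_imp_mem:
  assumes "N \<lhd> sym_group n" "p \<in> N" "g permutes {1..n}"
  shows "g \<circ> p \<circ> inv' g \<in> N"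
  using normal.inv_op_closed2[OF assms(1), of g p] assms
  by (simp add: sym_group_carrier sym_group_mult)

text \<open>
Three transpositions put \<open>a\<close>, \<open>b\<close>, \<open>c\<close> in place one after the other; each leaves the points that are
already placed where they are.
\<close>

lemma ex_permutes_three:
  assumes "distinct [a, b, c]" "distinct [a', b', c']" "{a, b, c, a', b', c'} \<subseteq> S"
  obtains g where "g permutes S" "g a = a'" "g b = b'" "g c = c'"
proof -
  define g1 where "g1 = transpose a a'"
  define g2 where "g2 = transpose (g1 b) b' \<circ> g1"
  define g3 where "g3 = transpose (g2 c) c' \<circ> g2"
  have g1: "g1 permutes S" using assms(3) by (auto simp: g1_def intro!: permutes_swap_id)
  have g2: "g2 permutes S"
    using g1 assms(3) permutes_in_image[OF g1, of b] by (auto simp: g2_def intro!: permutes_compose permutes_swap_id)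
  have g3: "g3 permutes S"
    using g2 assms(3) permutes_in_image[OF g2, of c] by (auto simp: g3_def intro!: permutes_compose permutes_swap_id)
  have "g1 a = a'" by (simp add: g1_def)
  then have "g2 a = a'" "g2 b = b'"
    using assms(1,2) inj_eq[OF permutes_inj[OF g1], of b a] by (auto simp: g2_def transpose_apply_other)
  then have "g3 a = a'" "g3 b = b'" "g3 c = c'"
    using assms(1,2) inj_eq[OF permutes_inj[OF g2], of c a] inj_eq[OF permutes_inj[OF g2], of c b]
    by (auto simp: g3_def transpose_apply_other)
  then show thesis using that g3 by blast
qed

lemma alt_group_subset_if_cyc:
  assumes N: "N \<lhd> sym_group n"
    and c: "cyc a b c \<in> N" "distinct [a, b, c]" "{a, b, c} \<subseteq> {1..n}"
  shows "carrier (alt_group n) \<subseteq> N"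
proof (rule alt_group_subset_if_cycs)
  show "subgroup N (sym_group n)" using N by (simp add: normal_def)
  fix a' b' c' assume *: "distinct [a', b', c']" "{a', b', c'} \<subseteq> {1..n}"
  obtain g where "g permutes {1..n}" "g a = a'" "g b = b'" "g c = c'"
    using ex_permutes_three[OF c(2) *(1), of "{1..n}"] *(2) c(3) by auto
  then show "cyc a' b' c' \<in> N"
    using permutes_conj_imp_mem[OF N c(1), of g] by (simp add: conj_cyc)
qed

lemma normal_commutator_mem:
  assumes N: "N \<lhd> sym_group n" and "\<sigma> \<in> N" "t permutes {1..n}"
  shows "t \<circ> \<sigma> \<circ> inv' t \<circ> inv' \<sigma> \<in> N"
proof -
  have sub: "subgroup N (sym_group n)" using N by (simp add: normal_def)
  show ?thesis
    using subgroup_comp_closed[OF sub permutes_conj_imp_mem[OF N assms(2,3)] subgroup_inv_closed[OF sub assms(2)]] .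
qed

text \<open>
A normal subgroup that contains a 3-cycle contains \<open>A\<^sub>n\<close>, so by the commutator argument only
fixed-point-free involutions are left. From \<open>\<sigma> = (a b)(c d)\<dots>\<close> the commutator with \<open>(a c)\<close> gives
\<open>(a c)(b d)\<close>; with a fifth point \<open>e\<close>, its product with the conjugate \<open>(a c)(b e)\<close> is a 3-cycle. The only
remaining case is \<open>n = 4\<close>, where the fixed-point-free involutions form the Klein four-group with the identity.
\<close>

theorem alt_group_subset_normal_subgroup:
  assumes N: "N \<lhd> sym_group n" and \<sigma>: "\<sigma> \<in> N" "\<sigma> \<noteq> id"
  shows "carrier (alt_group n) \<subseteq> N \<or> n = 4 \<and> (\<forall>x\<in>{1..n}. \<sigma> x \<noteq> x) \<and> (\<forall>x. \<sigma> (\<sigma> x) = x)"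
proof (rule disjCI)
  assume not4: "\<not> (n = 4 \<and> (\<forall>x\<in>{1..n}. \<sigma> x \<noteq> x) \<and> (\<forall>x. \<sigma> (\<sigma> x) = x))"
  have sub: "subgroup N (sym_group n)" using N by (simp add: normal_def)
  have perm: "\<sigma> permutes {1..n}" using subgroup_permutes[OF sub \<sigma>(1)] .
  show "carrier (alt_group n) \<subseteq> N"
  proof (rule ccontr)
    assume nsub: "\<not> carrier (alt_group n) \<subseteq> N"
    then have no_cyc: False if "cyc a b c \<in> N" "distinct [a, b, c]" "{a, b, c} \<subseteq> {1..n}" for a b c
      using alt_group_subset_if_cyc[OF N that] by blast
    have fpf: "\<forall>x\<in>{1..n}. \<sigma> x \<noteq> x" and inv: "\<forall>x. \<sigma> (\<sigma> x) = x"
      using three_cycle_commutator_or_fpf_involution[OF perm \<sigma>(2)] normal_commutator_mem[OF N \<sigma>(1)] no_cyc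
      by metis+
    have n3: "n \<ge> 3"
    proof (rule ccontr)
      assume "\<not> n \<ge> 3"
      then have "carrier (alt_group n) \<subseteq> N"
        using alt_group_subset_if_cycs_12[OF sub] by simp
      then show False using nsub by blast
    qed
    \<comment> \<open>Two different 2-cycles \<open>(a b)\<close> and \<open>(c d)\<close> of \<open>\<sigma>\<close>.\<close>
    define a b where "a = (1 :: nat)" and "b = \<sigma> 1"
    have ab: "a \<in> {1..n}" "b \<in> {1..n}" "a \<noteq> b" "\<sigma> a = b" "\<sigma> b = a"
      using n3 fpf[rule_format, of 1] inv permutes_in_image[OF perm, of 1] by (simp_all add: a_def b_def)
    have "card ({1..n} - {a, b}) > 0" using n3 ab by (simp add: card_Diff_subset)
    then have "{1..n} - {a, b} \<noteq> {}" by (metis card.empty less_irrefl)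
    then obtain c where c: "c \<in> {1..n}" "c \<noteq> a" "c \<noteq> b" by blast
    define d where "d = \<sigma> c"
    have d: "d \<in> {1..n}" "d \<noteq> c" "\<sigma> c = d" "\<sigma> d = c"
      using c(1) fpf inv permutes_in_image[OF perm, of c] by (simp_all add: d_def)
    have d': "d \<noteq> a" "d \<noteq> b" using d(4) ab(4,5) c(2,3) by metis+
    have "n \<noteq> 3"
    proof
      assume "n = 3"
      have "card {a, b, c, d} = 4" using ab c d d' by auto
      moreover have "card {a, b, c, d} \<le> card {1..n}" using ab c d by (intro card_mono) auto
      ultimately show False using \<open>n = 3\<close> by simp
    qed
    then have "n \<ge> 5" using not4 fpf inv n3 by force
    moreover have "card {a, b, c, d} = 4" using ab c d d' by auto
    ultimately have "card ({1..n} - {a, b, c, d}) > 0" using ab c d by (subst card_Diff_subset) auto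
    then have "{1..n} - {a, b, c, d} \<noteq> {}" by (metis card.empty less_irrefl)
    then obtain e where e: "e \<in> {1..n}" "e \<notin> {a, b, c, d}" by blast
    define p where "p = transpose a c \<circ> transpose b d"
    have p: "p \<in> N"
      using normal_commutator_mem[OF N \<sigma>(1), of "transpose a c"] commutator_transpose[OF perm, of a c] ab c d
      by (simp add: p_def permutes_swap_id)
    have q: "transpose d e \<circ> p \<circ> transpose d e \<in> N"
      using permutes_conj_imp_mem[OF N p, of "transpose d e"] d e by (simp add: permutes_swap_id)
    have dist: "distinct [a, b, c, d, e]" using ab(3) c(2,3) d(2) d' e(2) by auto
    have "p \<circ> (transpose d e \<circ> p \<circ> transpose d e) = cyc b e d"
    proof
      fix x
      consider "x = a" | "x = b" | "x = c" | "x = d" | "x = e" | "x \<notin> {a, b, c, d, e}" by blast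
      then show "(p \<circ> (transpose d e \<circ> p \<circ> transpose d e)) x = cyc b e d x"
        using dist by cases (auto simp: p_def cyc_def transpose_def)
    qed
    then have "cyc b e d \<in> N" using subgroup_comp_closed[OF sub p q] by simp
    then show False using no_cyc[of b e d] ab d d' e by auto
  qed
qed

lemma ex_two_elements: "finite A \<Longrightarrow> card A \<ge> 2 \<Longrightarrow> \<exists>u\<in>A. \<exists>v\<in>A. u \<noteq> v"
  using card_le_Suc0_iff_eq[of A] by force

text \<open>
The cycles of \<open>d\<close> are 3-cycles and fixed points. If there are two 3-cycles, then exchanging them
pointwise is a product of three transpositions that commutes with \<open>d\<close>. Otherwise at least two points are
fixed, and the transposition of two fixed points will do.
\<close>

lemma odd_centralizer_of_order_three:
  assumes d: "d permutes S" "d \<noteq> id" "d \<circ> d \<circ> d = id" and S: "finite S" "card S \<ge> 5"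
  obtains t where "t permutes S" "\<not> evenperm t" "t \<circ> d = d \<circ> t"
proof -
  have ddd: "d (d (d x)) = x" for x using d(3) by (simp add: fun_eq_iff)
  have eq: "d x = d y \<longleftrightarrow> x = y" for x y using permutes_inj[OF d(1)] by (simp add: inj_eq)
  have dd: "d (d x) \<noteq> x" if "d x \<noteq> x" for x using ddd[of x] that by metis
  have inS: "x \<in> S \<and> d x \<in> S \<and> d (d x) \<in> S" if "d x \<noteq> x" for x
    using that permutes_not_in[OF d(1)] permutes_in_image[OF d(1)] by metis
  obtain a where a: "d a \<noteq> a" using d(2) by (auto simp: fun_eq_iff)
  show thesis
  proof (cases "\<exists>x. d x \<noteq> x \<and> x \<notin> {a, d a, d (d a)}")
    case True
    then obtain x where x: "d x \<noteq> x" "x \<notin> {a, d a, d (d a)}" by blast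
    define b c y z where "b = d a" and "c = d (d a)" and "y = d x" and "z = d (d x)"
    have d_abc: "d a = b" "d b = c" "d c = a" "d x = y" "d y = z" "d z = x"
      using ddd by (simp_all add: b_def c_def y_def z_def)
    have dist: "distinct [a, b, c]" "distinct [x, y, z]"
      using a x dd[OF a] dd[OF x(1)] eq by (auto simp: b_def c_def y_def z_def)
    have "x \<notin> {a, b, c}" using x by (simp add: b_def c_def)
    then have "y \<notin> {a, b, c}" using d_abc eq by (metis insert_iff singletonD)
    then have "z \<notin> {a, b, c}" using d_abc eq by (metis insert_iff singletonD)
    note dist = dist \<open>x \<notin> {a, b, c}\<close> \<open>y \<notin> {a, b, c}\<close> \<open>z \<notin> {a, b, c}\<close>
    define t where "t = transpose a x \<circ> transpose b y \<circ> transpose c z"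
    have neq: "a \<noteq> b" "a \<noteq> c" "b \<noteq> c" "x \<noteq> y" "x \<noteq> z" "y \<noteq> z"
      "a \<noteq> x" "a \<noteq> y" "a \<noteq> z" "b \<noteq> x" "b \<noteq> y" "b \<noteq> z" "c \<noteq> x" "c \<noteq> y" "c \<noteq> z"
      using dist by auto
    have "t permutes S"
      using inS[OF a] inS[OF x(1)]
      by (auto simp: t_def b_def c_def y_def z_def intro!: permutes_compose permutes_swap_id)
    moreover have "\<not> evenperm t"
    proof -
      have "permutation (transpose b y \<circ> transpose c z)"
        by (intro permutation_compose permutation_swap_id)
      then show ?thesis
        by (simp add: neq t_def comp_assoc evenperm_comp[OF permutation_swap_id]
            permutation_swap_id evenperm_swap)
    qed
    moreover have "t \<circ> d = d \<circ> t"
    proof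
      fix w
      show "(t \<circ> d) w = (d \<circ> t) w"
      proof (cases "w \<in> {a, b, c, x, y, z}")
        case True
        then consider "w = a" | "w = b" | "w = c" | "w = x" | "w = y" | "w = z" by blast
        then show ?thesis by cases (simp_all add: t_def transpose_apply_other d_abc neq neq[symmetric])
      next
        case False
        then have "d w \<notin> {a, b, c, x, y, z}"
          using eq[of w a] eq[of w b] eq[of w c] eq[of w x] eq[of w y] eq[of w z] by (simp add: d_abc)
        then show ?thesis using False by (simp add: t_def transpose_apply_other)
      qed
    qed
    ultimately show thesis using that by blast
  next
    case False
    have "card {a, d a, d (d a)} \<le> 3" by (simp add: card_insert_if)
    then have "card (S - {a, d a, d (d a)}) \<ge> 2"
      using S diff_card_le_card_Diff[of "{a, d a, d (d a)}" S] by simp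
    then obtain u v where uv: "u \<in> S - {a, d a, d (d a)}" "v \<in> S - {a, d a, d (d a)}" "u \<noteq> v"
      using ex_two_elements[of "S - {a, d a, d (d a)}"] S(1) by blast
    then have "d u = u" "d v = v" using False by auto
    then have "transpose u v \<circ> d = d \<circ> transpose u v"
      using eq by (auto simp: transpose_def fun_eq_iff)
    then show thesis using that[of "transpose u v"] uv by (simp add: permutes_swap_id evenperm_swap)
  qed
qed

lemma eq_cycI:
  assumes dist: "distinct [a, d a, d (d a)]" and "d (d (d a)) = a"
    and fixed: "\<And>x. x \<notin> {a, d a, d (d a)} \<Longrightarrow> d x = x"
  shows "d = cyc a (d a) (d (d a))"
proof
  fix x
  have neq: "a \<noteq> d a" "a \<noteq> d (d a)" "d a \<noteq> d (d a)" using dist by simp_all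
  consider "x = a" | "x = d a" | "x = d (d a)" | "x \<notin> {a, d a, d (d a)}" by blast
  then show "d x = cyc a (d a) (d (d a)) x"
  proof cases
    case 4
    then show ?thesis using fixed[OF 4] by (simp add: cyc_apply(4))
  qed (simp_all add: cyc_apply(1-3) assms(2) neq)
qed

text \<open>
Two disjoint 3-cycles would need six points.
\<close>

lemma order_three_is_three_cycle:
  assumes d: "d permutes S" "d \<noteq> id" "d \<circ> d \<circ> d = id" and S: "finite S" "card S \<le> 5"
  shows "three_cycle S d"
proof -
  have ddd: "d (d (d x)) = x" for x using d(3) by (simp add: fun_eq_iff)
  have eq: "d x = d y \<longleftrightarrow> x = y" for x y using permutes_inj[OF d(1)] by (simp add: inj_eq)
  have dd: "d (d x) \<noteq> x" if "d x \<noteq> x" for x using ddd[of x] that by metis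
  have inS: "{x, d x, d (d x)} \<subseteq> S" if "d x \<noteq> x" for x
    using that permutes_not_in[OF d(1)] permutes_in_image[OF d(1)] by (metis empty_subsetI insert_subset)
  have dist: "distinct [x, d x, d (d x)]" if "d x \<noteq> x" for x
    using that dd[OF that] eq by auto
  obtain a where a: "d a \<noteq> a" using d(2) by (auto simp: fun_eq_iff)
  have "d x = x" if x: "x \<notin> {a, d a, d (d a)}" for x
  proof (rule ccontr)
    assume dx: "d x \<noteq> x"
    have "d x \<notin> {a, d a, d (d a)}" "d (d x) \<notin> {a, d a, d (d a)}"
      using x ddd eq by (metis insert_iff singletonD)+
    then have "{a, d a, d (d a)} \<inter> {x, d x, d (d x)} = {}"
      using x by (simp only: Int_insert_right_if0 Int_empty_right not_False_eq_True)
    then have "card ({a, d a, d (d a)} \<union> {x, d x, d (d x)}) = 6"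
      using dist[OF a] dist[OF dx] by (subst card_Un_disjoint) auto
    moreover have "card ({a, d a, d (d a)} \<union> {x, d x, d (d x)}) \<le> card S"
      using inS[OF a] inS[OF dx] S(1) by (intro card_mono) auto
    ultimately show False using S(2) by simp
  qed
  then have "d = cyc a (d a) (d (d a))"
    using eq_cycI[OF dist[OF a] ddd] by blast
  then show ?thesis using dist[OF a] inS[OF a] unfolding three_cycle_def by blast
qed

lemma odd_square_eq_id:
  assumes p: "p permutes S" "\<not> evenperm p" and S: "finite S" "card S \<le> 3"
  shows "p \<circ> p = id"
proof (rule ccontr)
  assume "p \<circ> p \<noteq> id"
  then obtain a where a: "p (p a) \<noteq> a" by (auto simp: fun_eq_iff)
  have eq: "p x = p y \<longleftrightarrow> x = y" for x y using permutes_inj[OF p(1)] by (simp add: inj_eq)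
  have a': "p a \<noteq> a" using a by metis
  then have dist: "distinct [a, p a, p (p a)]" using a by (simp add: eq)
  have sub: "{a, p a, p (p a)} \<subseteq> S"
    using a' permutes_not_in[OF p(1)] permutes_in_image[OF p(1)] by (metis empty_subsetI insert_subset)
  have "card {a, p a, p (p a)} = 3" using dist by auto
  then have S_eq: "S = {a, p a, p (p a)}" using card_subset_eq[OF S(1) sub] card_mono[OF S(1) sub] S(2) by simp
  have "p (p (p a)) \<in> S" using sub permutes_in_image[OF p(1)] by auto
  then have "p (p (p a)) = a" using a a' by (simp add: S_eq eq)
  then have "p = cyc a (p a) (p (p a))"
    using eq_cycI[of a p, OF dist] S_eq permutes_not_in[OF p(1)] by blast
  then show False using evenperm_cyc[OF dist] p(2) by simp
qed

lemma centralizer_of_cycs_trivial: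
  assumes \<sigma>: "\<sigma> permutes S" and S: "finite S" "card S \<ge> 4"
    and comm: "\<And>a b c. distinct [a, b, c] \<Longrightarrow> {a, b, c} \<subseteq> S \<Longrightarrow> \<sigma> \<circ> cyc a b c = cyc a b c \<circ> \<sigma>"
  shows "\<sigma> = id"
proof (rule ccontr)
  assume "\<sigma> \<noteq> id"
  then obtain a where a: "\<sigma> a \<noteq> a" by (auto simp: fun_eq_iff)
  then have aS: "{a, \<sigma> a} \<subseteq> S"
    using permutes_not_in[OF \<sigma>] permutes_in_image[OF \<sigma>] by (metis empty_subsetI insert_subset)
  have "card (S - {a, \<sigma> a}) \<ge> 2"
    using S aS a by (subst card_Diff_subset) auto
  then obtain c d where cd: "c \<in> S - {a, \<sigma> a}" "d \<in> S - {a, \<sigma> a}" "c \<noteq> d"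
    using ex_two_elements[of "S - {a, \<sigma> a}"] S(1) by blast
  have "\<sigma> (cyc a c d a) = cyc a c d (\<sigma> a)"
    using comm[of a c d] cd aS by (auto simp: fun_eq_iff)
  then have "\<sigma> c = \<sigma> a" using a cd by (auto simp: cyc_def split: if_splits)
  then show False using permutes_inj[OF \<sigma>] cd by (auto simp: inj_eq)
qed

text \<open>
A fixed-point-free involution of four points is determined by the image of the point \<open>1\<close>, since the other
two points have to be exchanged. Hence the transposition of \<open>\<sigma> 1\<close> and \<open>\<tau> 1\<close> conjugates \<open>\<sigma>\<close> to \<open>\<tau>\<close>.
\<close>

lemma fpf_involutions_conjugate:
  fixes \<sigma> \<tau> :: "nat \<Rightarrow> nat"
  assumes \<sigma>: "\<sigma> permutes {1..4}" "\<forall>x\<in>{1..4}. \<sigma> x \<noteq> x" "\<forall>x. \<sigma> (\<sigma> x) = x"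
    and \<tau>: "\<tau> permutes {1..4}" "\<forall>x\<in>{1..4}. \<tau> x \<noteq> x" "\<forall>x. \<tau> (\<tau> x) = x"
  obtains g where "g permutes {1..4}" "g \<circ> \<sigma> = \<tau> \<circ> g"
proof -
  have same: "\<rho> = \<rho>'"
    if \<rho>: "\<rho> permutes {1..4}" "\<forall>x\<in>{1..4}. \<rho> x \<noteq> x" "\<forall>x. \<rho> (\<rho> x) = x"
      and \<rho>': "\<rho>' permutes {1..4}" "\<forall>x\<in>{1..4}. \<rho>' x \<noteq> x" "\<forall>x. \<rho>' (\<rho>' x) = x" and e1: "\<rho> 1 = \<rho>' 1"
    for \<rho> \<rho>' :: "nat \<Rightarrow> nat"
  proof
    fix x
    let ?b = "\<rho> 1"
    have b: "?b \<in> {1..4}" "?b \<noteq> 1" using \<rho>(2) permutes_in_image[OF \<rho>(1), of 1] by auto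
    consider "x \<notin> {1..4}" | "x = 1" | "x = ?b" | "x \<in> {1..4} - {1, ?b}" by blast
    then show "\<rho> x = \<rho>' x"
    proof cases
      case 1
      then show ?thesis using permutes_not_in[OF \<rho>(1)] permutes_not_in[OF \<rho>'(1)] by simp
    next
      case 2
      then show ?thesis using e1 by simp
    next
      case 3
      then show ?thesis using \<rho>(3)[rule_format, of 1] \<rho>'(3)[rule_format, of 1] e1 by simp
    next
      case 4
      have avoid: "\<pi> x \<in> {1..4} - {1, ?b, x}"
        if "\<pi> permutes {1..4}" "\<forall>x\<in>{1..4}. \<pi> x \<noteq> x" "\<forall>x. \<pi> (\<pi> x) = x" "\<pi> 1 = ?b" for \<pi>
      proof -
        have "\<pi> x \<in> {1..4}" "\<pi> x \<noteq> x" using that(1,2) 4 permutes_in_image[OF that(1), of x] by blast+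
        moreover have "\<pi> x \<noteq> 1" "\<pi> x \<noteq> ?b" using that(3,4) 4 by (metis DiffE insertCI)+
        ultimately show ?thesis by blast
      qed
      have "\<rho> x \<in> {1..4} - {1, ?b, x}" "\<rho>' x \<in> {1..4} - {1, ?b, x}"
        using avoid[OF \<rho>] avoid[OF \<rho>'] e1 by simp_all
      moreover have "card ({1..4} - {1, ?b, x}) = 1" using 4 b by (subst card_Diff_subset) auto
      ultimately show ?thesis by (metis card_1_singletonE singletonD)
    qed
  qed
  define g where "g = transpose (\<sigma> 1) (\<tau> 1)"
  have g: "g permutes {1..4}"
    unfolding g_def
    using permutes_in_image[OF \<sigma>(1), of 1] permutes_in_image[OF \<tau>(1), of 1] by (intro permutes_swap_id) auto
  have gg: "g (g x) = x" for x by (simp add: g_def)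
  have "g \<circ> \<sigma> \<circ> g = \<tau>"
  proof (rule same[OF _ _ _ \<tau>])
    show "g \<circ> \<sigma> \<circ> g permutes {1..4}" using g \<sigma>(1) by (intro permutes_compose)
    show "\<forall>x\<in>{1..4}. (g \<circ> \<sigma> \<circ> g) x \<noteq> x"
      using \<sigma>(2) gg permutes_in_image[OF g] by (metis comp_apply)
    show "\<forall>x. (g \<circ> \<sigma> \<circ> g) ((g \<circ> \<sigma> \<circ> g) x) = x" using \<sigma>(3) gg by simp
    show "(g \<circ> \<sigma> \<circ> g) 1 = \<tau> 1"
      using \<sigma>(2)[rule_format, of 1] \<tau>(2)[rule_format, of 1] by (simp add: g_def transpose_def)
  qed
  then have "g \<circ> \<sigma> = \<tau> \<circ> g" using gg by (metis comp_apply ext)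
  then show thesis using that g by blast
qed

section \<open>Displacement subgroups and extension of automorphisms in abstract groups\<close>

text \<open>
For \<open>Q(G,\<psi>)\<close> this is the displacement group (also called transvection group) of the quandle: left
multiplication by \<open>x \<psi>(x)\<^sup>-\<^sup>1\<close> is the permutation \<open>s\<^sub>x \<circ> s\<^sub>1\<^sup>-\<^sup>1\<close>.
\<close>

definition displacement :: "('a, 'b) monoid_scheme \<Rightarrow> ('a \<Rightarrow> 'a) \<Rightarrow> 'a set" where
  "displacement G \<psi> = generate G ((\<lambda>x. x \<otimes>\<^bsub>G\<^esub> inv\<^bsub>G\<^esub> (\<psi> x)) ` carrier G)"

context group
begin

lemma cancel_inv:
  assumes "x \<in> carrier G" "y \<in> carrier G"
  shows "inv x \<otimes> (x \<otimes> y) = y" "x \<otimes> (inv x \<otimes> y) = y"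
  using assms by (simp_all add: m_assoc[symmetric])

lemma auto_hom: "\<psi> \<in> auto G \<Longrightarrow> \<psi> \<in> hom G G"
  by (simp add: auto_def)

lemma auto_bij: "\<psi> \<in> auto G \<Longrightarrow> bij_betw \<psi> (carrier G) (carrier G)"
  by (simp add: auto_def Bij_def)

lemma auto_closed: "\<psi> \<in> auto G \<Longrightarrow> x \<in> carrier G \<Longrightarrow> \<psi> x \<in> carrier G"
  by (auto simp: auto_def hom_def)

lemma auto_mult:
  "\<psi> \<in> auto G \<Longrightarrow> x \<in> carrier G \<Longrightarrow> y \<in> carrier G \<Longrightarrow> \<psi> (x \<otimes> y) = \<psi> x \<otimes> \<psi> y"
  by (simp add: auto_def hom_mult)

lemma auto_inv: "\<psi> \<in> auto G \<Longrightarrow> x \<in> carrier G \<Longrightarrow> \<psi> (inv x) = inv (\<psi> x)"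
  using group_hom.hom_inv[of G G \<psi> x] by (simp add: group_hom_def group_hom_axioms_def auto_hom is_group)

lemma auto_one: "\<psi> \<in> auto G \<Longrightarrow> \<psi> \<one> = \<one>"
  using group_hom.hom_one[of G G \<psi>] by (simp add: group_hom_def group_hom_axioms_def auto_hom is_group)

lemma auto_eqI:
  assumes "\<phi> \<in> auto G" "\<psi> \<in> auto G" "\<And>x. x \<in> carrier G \<Longrightarrow> \<phi> x = \<psi> x"
  shows "\<phi> = \<psi>"
  using assms extensionalityI[of \<phi> "carrier G" \<psi>] by (simp add: auto_def Bij_def)

lemma restrict_in_auto:
  assumes "bij_betw f (carrier G) (carrier G)"
    and "\<And>x y. x \<in> carrier G \<Longrightarrow> y \<in> carrier G \<Longrightarrow> f (x \<otimes> y) = f x \<otimes> f y"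
  shows "restrict f (carrier G) \<in> auto G"
  using assms bij_betwE[OF assms(1)]
  by (auto simp: auto_def Bij_def hom_def cong: bij_betw_cong)

text \<open>
Conjugacy as an intertwining condition: it mentions neither the inverse in \<open>AutoGroup G\<close>
nor its composition of extensional functions.
\<close>

lemma conjugate_in_AutoGroup_iff:
  assumes "\<psi> \<in> auto G" "\<psi>' \<in> auto G"
  shows "conjugate_in (AutoGroup G) \<psi> \<psi>' \<longleftrightarrow>
    (\<exists>\<theta>\<in>auto G. \<forall>x\<in>carrier G. \<theta> (\<psi> x) = \<psi>' (\<theta> x))"
proof -
  interpret A: group "AutoGroup G" by (rule AutoGroup)
  have carrier: "carrier (AutoGroup G) = auto G" by (rule carrier_AutoGroup)
  have mult: "(\<theta> \<otimes>\<^bsub>AutoGroup G\<^esub> \<phi>) x = \<theta> (\<phi> x)"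
    if "\<theta> \<in> auto G" "\<phi> \<in> auto G" "x \<in> carrier G" for \<theta> \<phi> x
    using that by (simp add: AutoGroup_def BijGroup_def auto_def compose_def)
  have "\<psi>' = \<theta> \<otimes>\<^bsub>AutoGroup G\<^esub> \<psi> \<otimes>\<^bsub>AutoGroup G\<^esub> inv\<^bsub>AutoGroup G\<^esub> \<theta> \<longleftrightarrow>
      (\<forall>x\<in>carrier G. \<theta> (\<psi> x) = \<psi>' (\<theta> x))" if \<theta>: "\<theta> \<in> auto G" for \<theta>
  proof -
    have "\<psi>' = \<theta> \<otimes>\<^bsub>AutoGroup G\<^esub> \<psi> \<otimes>\<^bsub>AutoGroup G\<^esub> inv\<^bsub>AutoGroup G\<^esub> \<theta> \<longleftrightarrow>
        \<theta> \<otimes>\<^bsub>AutoGroup G\<^esub> \<psi> = \<psi>' \<otimes>\<^bsub>AutoGroup G\<^esub> \<theta>"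
      using A.inv_solve_right[of \<psi>' "\<theta> \<otimes>\<^bsub>AutoGroup G\<^esub> \<psi>" \<theta>] A.m_closed[of \<theta> \<psi>] \<theta> assms
      by (auto simp: carrier)
    also have "\<dots> \<longleftrightarrow> (\<forall>x\<in>carrier G. \<theta> (\<psi> x) = \<psi>' (\<theta> x))"
      using auto_eqI[of "\<theta> \<otimes>\<^bsub>AutoGroup G\<^esub> \<psi>" "\<psi>' \<otimes>\<^bsub>AutoGroup G\<^esub> \<theta>"]
        A.m_closed[of \<theta> \<psi>] A.m_closed[of \<psi>' \<theta>] mult[OF \<theta> assms(1)] mult[OF assms(2) \<theta>] \<theta> assms
      by (auto simp: carrier)
    finally show ?thesis .
  qed
  then show ?thesis unfolding conjugate_in_def carrier by blast
qed

lemma quandle_isomorphic_if_conjugate: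
  assumes \<psi>: "\<psi> \<in> auto G" and \<psi>': "\<psi>' \<in> auto G" and "conjugate_in (AutoGroup G) \<psi> \<psi>'"
  shows "quandle_isomorphic (gen_alexander_quandle G \<psi>) (gen_alexander_quandle G \<psi>')"
proof -
  obtain \<theta> where \<theta>: "\<theta> \<in> auto G" and comm: "\<And>x. x \<in> carrier G \<Longrightarrow> \<theta> (\<psi> x) = \<psi>' (\<theta> x)"
    using assms(3) conjugate_in_AutoGroup_iff[OF \<psi> \<psi>'] by blast
  have "\<theta> \<in> quandle_iso (gen_alexander_quandle G \<psi>) (gen_alexander_quandle G \<psi>')"
    using auto_bij[OF \<theta>]
    by (simp add: quandle_iso_def gen_alexander_quandle_def auto_closed \<psi> \<psi>' \<theta> auto_mult auto_inv comm)
  then show ?thesis unfolding quandle_isomorphic_def by blast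
qed

lemma displacement_generators_subset:
  "\<psi> \<in> auto G \<Longrightarrow> (\<lambda>x. x \<otimes> inv (\<psi> x)) ` carrier G \<subseteq> carrier G"
  by (auto simp: auto_closed)

lemma displacement_mem: "x \<in> carrier G \<Longrightarrow> x \<otimes> inv (\<psi> x) \<in> displacement G \<psi>"
  unfolding displacement_def by (rule generate.incl) blast

text \<open>
A conjugate of a generator is a quotient of two generators:
\<open>g (x \<psi>(x)\<^sup>-\<^sup>1) g\<^sup>-\<^sup>1 = (g x \<psi>(g x)\<^sup>-\<^sup>1) (g \<psi>(g)\<^sup>-\<^sup>1)\<^sup>-\<^sup>1\<close>.
\<close>

lemma displacement_normal:
  assumes \<psi>: "\<psi> \<in> auto G"
  shows "displacement G \<psi> \<lhd> G"
proof -
  let ?d = "\<lambda>x. x \<otimes> inv (\<psi> x)"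
  let ?P = "displacement G \<psi>"
  have sub: "subgroup ?P G"
    unfolding displacement_def by (rule generate_is_subgroup[OF displacement_generators_subset[OF \<psi>]])
  have step: "g \<otimes> ?d x \<otimes> inv g \<in> ?P" if g: "g \<in> carrier G" and x: "x \<in> carrier G" for g x
  proof -
    have "g \<otimes> ?d x \<otimes> inv g = ?d (g \<otimes> x) \<otimes> inv (?d g)"
      using g x auto_closed[OF \<psi>] by (simp add: auto_mult[OF \<psi>] inv_mult_group m_assoc cancel_inv)
    moreover have "?d (g \<otimes> x) \<in> ?P" "inv (?d g) \<in> ?P"
      using g x displacement_mem sub by (simp_all add: subgroup.m_inv_closed)
    ultimately show ?thesis using subgroup.m_closed[OF sub] by simp
  qed
  show ?thesis
  proof (rule normal_invI[OF sub])
    fix g h assume g: "g \<in> carrier G" and "h \<in> ?P"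
    from this(2) show "g \<otimes> h \<otimes> inv g \<in> ?P"
      unfolding displacement_def
    proof (induction h rule: generate.induct)
      case one
      then show ?case using g generate.one by simp
    next
      case (incl h)
      then show ?case using step[OF g] unfolding displacement_def by blast
    next
      case (inv h)
      then obtain x where x: "x \<in> carrier G" "h = ?d x" by blast
      then have "inv (g \<otimes> h \<otimes> inv g) \<in> ?P"
        using step[OF g x(1)] subgroup.m_inv_closed[OF sub] by simp
      then show ?case
        using x g auto_closed[OF \<psi>] by (simp add: inv_mult_group m_assoc displacement_def)
    next
      case (eng h k)
      have hk: "h \<in> carrier G" "k \<in> carrier G"
        using eng.hyps generate_in_carrier[OF displacement_generators_subset[OF \<psi>]] by blast+
      have "(g \<otimes> h \<otimes> inv g) \<otimes> (g \<otimes> k \<otimes> inv g) = g \<otimes> (h \<otimes> k) \<otimes> inv g"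
        using hk g by (simp add: m_assoc cancel_inv)
      then show ?case using generate.eng[OF eng.IH] by simp
    qed
  qed
qed

lemma displacement_trivial_imp_id:
  assumes \<psi>: "\<psi> \<in> auto G" and "displacement G \<psi> \<subseteq> {\<one>}" and x: "x \<in> carrier G"
  shows "\<psi> x = x"
proof -
  have "x \<otimes> inv (\<psi> x) = \<one>" using displacement_mem[OF x, of \<psi>] assms(2) by blast
  then show ?thesis using inv_equality[of x "inv (\<psi> x)"] x auto_closed[OF \<psi> x] by simp
qed

lemma auto_preserves_if_displacement_le:
  assumes \<psi>: "\<psi> \<in> auto G" and "displacement G \<psi> \<subseteq> A" "subgroup A G" and a: "a \<in> A"
  shows "\<psi> a \<in> A"
proof -
  have aG: "a \<in> carrier G" using subgroup.mem_carrier[OF assms(3) a] .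
  have "inv (a \<otimes> inv (\<psi> a)) \<otimes> a \<in> A"
    using displacement_mem[OF aG, of \<psi>] assms(2-4) by (meson subgroup.m_closed subgroup.m_inv_closed subsetD)
  then show ?thesis using aG auto_closed[OF \<psi> aG] by (simp add: inv_mult_group m_assoc)
qed

text \<open>
What a quandle isomorphism that fixes the unit says in terms of the group. The equivariance under the
displacement subgroup is the part of multiplicativity that survives, since \<open>f\<close> need not be a homomorphism.
\<close>

definition pointed_iso :: "('a \<Rightarrow> 'a) \<Rightarrow> ('a \<Rightarrow> 'a) \<Rightarrow> ('a \<Rightarrow> 'a) \<Rightarrow> bool" where
  "pointed_iso \<psi> \<psi>' f \<longleftrightarrow> bij_betw f (carrier G) (carrier G) \<and> f \<one> = \<one> \<and>
     (\<forall>x\<in>carrier G. f (\<psi> x) = \<psi>' (f x)) \<and>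
     (\<forall>p\<in>displacement G \<psi>. \<forall>x\<in>carrier G. f (p \<otimes> x) = f p \<otimes> f x) \<and>
     f ` displacement G \<psi> = displacement G \<psi>'"

text \<open>
Any isomorphism \<open>h\<close> is made to fix the unit by composing it with left multiplication by \<open>h(1)\<^sup>-\<^sup>1\<close>. The
condition at \<open>x = 1\<close> then reads \<open>f \<circ> \<psi> = \<psi>' \<circ> f\<close>, and with \<open>z = \<psi>(y)\<close> the general condition
becomes \<open>f(x \<psi>(x)\<^sup>-\<^sup>1 z) = f(x) \<psi>'(f(x))\<^sup>-\<^sup>1 f(z)\<close>. So \<open>f\<close> maps generators of the displacement subgroup onto
generators and is equivariant under them; both facts pass to products and inverses.
\<close>

lemma quandle_isomorphic_imp_pointed_iso:
  assumes \<psi>: "\<psi> \<in> auto G" and \<psi>': "\<psi>' \<in> auto G"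
    and "quandle_isomorphic (gen_alexander_quandle G \<psi>) (gen_alexander_quandle G \<psi>')"
  shows "\<exists>f. pointed_iso \<psi> \<psi>' f"
proof -
  obtain h where h: "bij_betw h (carrier G) (carrier G)"
    and hq: "\<And>x y. x \<in> carrier G \<Longrightarrow> y \<in> carrier G \<Longrightarrow>
      h (x \<otimes> \<psi> (inv x \<otimes> y)) = h x \<otimes> \<psi>' (inv (h x) \<otimes> h y)"
    using assms(3) bij_betwE
    by (fastforce simp: quandle_isomorphic_def quandle_iso_def gen_alexander_quandle_def)
  have hG: "h x \<in> carrier G" if "x \<in> carrier G" for x using h that bij_betwE by blast
  define c where "c = inv (h \<one>)"
  have c: "c \<in> carrier G" using hG by (simp add: c_def)
  define f where "f x = c \<otimes> h x" for x
  have fG: "f x \<in> carrier G" if "x \<in> carrier G" for x using c hG that by (simp add: f_def)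
  have "bij_betw (\<lambda>x. c \<otimes> x) (carrier G) (carrier G)"
    by (rule bij_betwI[of _ _ _ "\<lambda>x. inv c \<otimes> x"]) (use c in \<open>auto simp: m_assoc[symmetric]\<close>)
  then have f_bij: "bij_betw f (carrier G) (carrier G)"
    using bij_betw_trans[OF h] by (simp add: f_def comp_def cong: bij_betw_cong)
  have f1: "f \<one> = \<one>" using hG by (simp add: f_def c_def)
  have fq: "f (x \<otimes> \<psi> (inv x \<otimes> y)) = f x \<otimes> \<psi>' (inv (f x) \<otimes> f y)"
    if "x \<in> carrier G" "y \<in> carrier G" for x y
  proof -
    have "inv (f x) \<otimes> f y = inv (h x) \<otimes> h y"
      using that c hG by (simp add: f_def inv_mult_group m_assoc cancel_inv)
    then show ?thesis
      using hq[OF that] that c hG auto_closed[OF \<psi>'] by (simp add: f_def m_assoc)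
  qed
  have f\<psi>: "f (\<psi> x) = \<psi>' (f x)" if "x \<in> carrier G" for x
    using fq[OF one_closed that] that f1 fG auto_closed[OF \<psi>] auto_closed[OF \<psi>'] by simp
  let ?d = "\<lambda>x. x \<otimes> inv (\<psi> x)"
  let ?d' = "\<lambda>x. x \<otimes> inv (\<psi>' x)"
  have gen: "f (?d x \<otimes> z) = ?d' (f x) \<otimes> f z" if x: "x \<in> carrier G" and z: "z \<in> carrier G" for x z
  proof -
    obtain y where y: "y \<in> carrier G" "z = \<psi> y"
      using auto_bij[OF \<psi>] z by (metis bij_betw_imp_surj_on imageE)
    show ?thesis
      using fq[OF x y(1)] x y fG auto_closed[OF \<psi>] auto_closed[OF \<psi>'] f\<psi>
      by (simp add: auto_mult[OF \<psi>] auto_mult[OF \<psi>'] auto_inv[OF \<psi>] auto_inv[OF \<psi>'] m_assoc)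
  qed
  have gen1: "f (?d x) = ?d' (f x)" if x: "x \<in> carrier G" for x
    using gen[OF x one_closed] x f1 fG auto_closed[OF \<psi>] auto_closed[OF \<psi>'] by simp
  have PG: "p \<in> carrier G" if "p \<in> displacement G \<psi>" for p
    using that generate_in_carrier[OF displacement_generators_subset[OF \<psi>]] by (simp add: displacement_def)
  have sub': "subgroup (displacement G \<psi>') G" using displacement_normal[OF \<psi>'] by (simp add: normal_def)
  have P: "f p \<in> displacement G \<psi>' \<and> (\<forall>z\<in>carrier G. f (p \<otimes> z) = f p \<otimes> f z)"
    if "p \<in> displacement G \<psi>" for p
    using that unfolding displacement_def[of G \<psi>]
  proof (induction p rule: generate.induct)
    case one
    then show ?case using f1 fG subgroup.one_closed[OF sub'] by simp
  next
    case (incl h)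
    then show ?case using gen gen1 displacement_mem[of _ \<psi>'] fG by auto
  next
    case (inv h)
    then obtain x where x: "x \<in> carrier G" "h = ?d x" by blast
    have hG: "h \<in> carrier G" using x auto_closed[OF \<psi>] by simp
    have fh: "f h \<in> displacement G \<psi>'" using x gen1 displacement_mem[of "f x" \<psi>'] fG by simp
    have key: "f (inv h \<otimes> z) = inv (f h) \<otimes> f z" if z: "z \<in> carrier G" for z
    proof -
      have "f z = f (h \<otimes> (inv h \<otimes> z))" using hG z by (simp add: m_assoc[symmetric])
      also have "\<dots> = f h \<otimes> f (inv h \<otimes> z)" using gen[OF x(1), of "inv h \<otimes> z"] gen1[OF x(1)] x hG z by simp
      finally show ?thesis using hG z fG by (simp add: inv_solve_left)
    qed
    have "f (inv h) = inv (f h)" using key[OF one_closed] hG f1 fG by simp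
    then show ?case using key subgroup.m_inv_closed[OF sub' fh] by simp
  next
    case (eng h k)
    have hk: "h \<in> carrier G" "k \<in> carrier G"
      using eng.hyps PG by (simp_all add: displacement_def)
    then show ?case
      using eng.IH fG subgroup.m_closed[OF sub'] by (simp add: m_assoc)
  qed
  have "q \<in> f ` displacement G \<psi>" if "q \<in> displacement G \<psi>'" for q
    using that unfolding displacement_def[of G \<psi>']
  proof (induction q rule: generate.induct)
    case one
    then show ?case using f1 generate.one unfolding displacement_def by (metis image_eqI)
  next
    case (incl h)
    then obtain y where y: "y \<in> carrier G" "h = ?d' y" by blast
    then obtain x where "x \<in> carrier G" "y = f x"
      using f_bij by (metis bij_betw_imp_surj_on imageE)
    then show ?case using y gen1 displacement_mem by (metis image_eqI)
  next
    case (inv h)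
    then obtain y where y: "y \<in> carrier G" "h = ?d' y" by blast
    then obtain x where x: "x \<in> carrier G" "y = f x"
      using f_bij by (metis bij_betw_imp_surj_on imageE)
    let ?p = "?d x"
    have p: "?p \<in> displacement G \<psi>" using displacement_mem x by blast
    then have ip: "inv ?p \<in> displacement G \<psi>"
      using displacement_normal[OF \<psi>] subgroup.m_inv_closed by (metis normal_def)
    have "f ?p \<otimes> f (inv ?p) = \<one>" using P[OF p] PG[OF p] f1 by (metis inv_closed r_inv)
    then have "f (inv ?p) = inv (f ?p)" using PG[OF p] fG by (metis inv_closed inv_equality inv_inv)
    then have "inv h = f (inv ?p)" using gen1[OF x(1)] x y by simp
    then show ?case using ip by blast
  next
    case (eng h k)
    then obtain p q where pq: "p \<in> displacement G \<psi>" "q \<in> displacement G \<psi>" "h = f p" "k = f q" by blast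
    then have "h \<otimes> k = f (p \<otimes> q)" using P PG by simp
    moreover have "p \<otimes> q \<in> displacement G \<psi>"
      using displacement_normal[OF \<psi>] subgroup.m_closed pq by (metis normal_def)
    ultimately show ?case by blast
  qed
  then have "f ` displacement G \<psi> = displacement G \<psi>'" using P by blast
  then show ?thesis unfolding pointed_iso_def using f_bij f1 f\<psi> P by blast
qed

text \<open>
For \<open>a\<close> in \<open>A\<close> both \<open>\<phi> x\<close> and \<open>\<chi> x\<close> conjugate \<open>\<phi> a = \<chi> a\<close> to the common value of \<open>\<phi>\<close> and \<open>\<chi>\<close> at
\<open>x a x\<^sup>-\<^sup>1\<close>. Hence \<open>(\<chi> x)\<^sup>-\<^sup>1 (\<phi> x)\<close> centralizes \<open>A\<close>.
\<close>

lemma auto_eq_if_eq_on_faithful: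
  assumes A: "A \<lhd> G" and faithful: "\<And>g. g \<in> carrier G \<Longrightarrow> (\<And>a. a \<in> A \<Longrightarrow> g \<otimes> a = a \<otimes> g) \<Longrightarrow> g = \<one>"
    and \<phi>: "\<phi> \<in> hom G G" and \<chi>: "\<chi> \<in> hom G G"
    and eq: "\<And>a. a \<in> A \<Longrightarrow> \<phi> a = \<chi> a" and onto: "\<phi> ` A = A" and x: "x \<in> carrier G"
  shows "\<phi> x = \<chi> x"
proof -
  have AG: "a \<in> carrier G" if "a \<in> A" for a using A that normal_imp_subgroup subgroup.mem_carrier by metis
  have c: "\<phi> x \<in> carrier G" "\<chi> x \<in> carrier G" using \<phi> \<chi> x by (simp_all add: hom_in_carrier)
  have "inv (\<chi> x) \<otimes> \<phi> x = \<one>"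
  proof (rule faithful)
    show "inv (\<chi> x) \<otimes> \<phi> x \<in> carrier G" using c by simp
    fix b assume "b \<in> A"
    then obtain a where a: "a \<in> A" "b = \<phi> a" using onto by blast
    have xa: "x \<otimes> a \<otimes> inv x \<in> A" using normal.inv_op_closed2[OF A x a(1)] .
    define e where "e = x \<otimes> a \<otimes> inv x"
    have ex: "e \<otimes> x = x \<otimes> a" using x AG[OF a(1)] by (simp add: e_def m_assoc)
    have eA: "e \<in> A" using xa by (simp add: e_def)
    have bG: "b \<in> carrier G" using \<open>b \<in> A\<close> AG by simp
    have eG: "\<phi> e \<in> carrier G" using \<phi> AG[OF eA] by (simp add: hom_in_carrier)
    have 1: "\<phi> e \<otimes> \<phi> x = \<phi> x \<otimes> b"
      using ex AG[OF eA] AG[OF a(1)] x a(2) hom_mult[OF \<phi>] by metis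
    have 2: "\<phi> e \<otimes> \<chi> x = \<chi> x \<otimes> b"
      using ex AG[OF eA] AG[OF a(1)] x a eq eA hom_mult[OF \<chi>] by metis
    have "inv (\<chi> x) \<otimes> \<phi> x \<otimes> b = inv (\<chi> x) \<otimes> \<phi> e \<otimes> \<phi> x"
      using 1 c eG bG by (simp add: m_assoc)
    also have "inv (\<chi> x) \<otimes> \<phi> e = b \<otimes> inv (\<chi> x)"
      using 2 c eG bG by (metis inv_solve_left inv_solve_right m_assoc m_closed inv_closed)
    finally show "inv (\<chi> x) \<otimes> \<phi> x \<otimes> b = b \<otimes> (inv (\<chi> x) \<otimes> \<phi> x)"
      using c bG by (simp add: m_assoc)
  qed
  then show ?thesis using c by (metis inv_closed inv_equality inv_inv)
qed

text \<open>
With \<open>A\<close> having trivial centralizer, \<open>G\<close> embeds into the automorphism group of \<open>A\<close> by conjugation.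
The last assumption says that \<open>\<alpha>\<close> normalizes the image of this embedding, and conjugation by \<open>\<alpha>\<close> on the
image is the wanted automorphism of \<open>G\<close>.
\<close>

lemma extend_automorphism_of_faithful:
  assumes fin: "finite (carrier G)"
    and A: "A \<lhd> G" and faithful: "\<And>g. g \<in> carrier G \<Longrightarrow> (\<And>a. a \<in> A \<Longrightarrow> g \<otimes> a = a \<otimes> g) \<Longrightarrow> g = \<one>"
    and \<alpha>: "bij_betw \<alpha> A A" "\<And>a b. a \<in> A \<Longrightarrow> b \<in> A \<Longrightarrow> \<alpha> (a \<otimes> b) = \<alpha> a \<otimes> \<alpha> b"
    and normalises: "\<And>x. x \<in> carrier G \<Longrightarrow> \<exists>g\<in>carrier G. \<forall>a\<in>A. \<alpha> (x \<otimes> a \<otimes> inv x) = g \<otimes> \<alpha> a \<otimes> inv g"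
  obtains \<theta> where "\<theta> \<in> auto G" "\<And>a. a \<in> A \<Longrightarrow> \<theta> a = \<alpha> a"
proof -
  have AG: "a \<in> carrier G" if "a \<in> A" for a using A that normal_imp_subgroup subgroup.mem_carrier by metis
  have \<alpha>A: "\<alpha> a \<in> A" if "a \<in> A" for a using \<alpha>(1) that bij_betwE by blast
  have conjA: "x \<otimes> a \<otimes> inv x \<in> A" if "x \<in> carrier G" "a \<in> A" for x a
    using normal.inv_op_closed2[OF A that] .
  have conj_mult: "x \<otimes> y \<otimes> a \<otimes> inv (x \<otimes> y) = x \<otimes> (y \<otimes> a \<otimes> inv y) \<otimes> inv x"
    if "x \<in> carrier G" "y \<in> carrier G" "a \<in> carrier G" for x y a
    using that by (simp add: inv_mult_group m_assoc)
  have unique: "g = h"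
    if g: "g \<in> carrier G" and h: "h \<in> carrier G"
      and eq: "\<And>a. a \<in> A \<Longrightarrow> g \<otimes> \<alpha> a \<otimes> inv g = h \<otimes> \<alpha> a \<otimes> inv h" for g h
  proof -
    have "inv h \<otimes> g = \<one>"
    proof (rule faithful)
      show "inv h \<otimes> g \<in> carrier G" using g h by simp
      fix b assume "b \<in> A"
      then obtain a where a: "a \<in> A" "b = \<alpha> a" using \<alpha>(1) by (metis bij_betw_imp_surj_on imageE)
      have bG: "b \<in> carrier G" using AG \<open>b \<in> A\<close> .
      have "inv h \<otimes> g \<otimes> b = inv h \<otimes> (g \<otimes> b \<otimes> inv g) \<otimes> g" using g h bG by (simp add: m_assoc)
      also have "g \<otimes> b \<otimes> inv g = h \<otimes> b \<otimes> inv h" using eq[OF a(1)] a(2) by simp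
      also have "inv h \<otimes> (h \<otimes> b \<otimes> inv h) \<otimes> g = b \<otimes> (inv h \<otimes> g)"
        using g h bG by (simp add: m_assoc[symmetric])
      finally show "inv h \<otimes> g \<otimes> b = b \<otimes> (inv h \<otimes> g)" .
    qed
    then have "inv g = inv h" using g h by (simp add: inv_equality)
    then show ?thesis using g h by (metis inv_inv)
  qed
  \<comment> \<open>Faithfulness makes the choice of \<open>g\<close> unique, so that \<open>\<theta>\<close> is multiplicative.\<close>
  define \<theta> where "\<theta> x = (SOME g. g \<in> carrier G \<and> (\<forall>a\<in>A. \<alpha> (x \<otimes> a \<otimes> inv x) = g \<otimes> \<alpha> a \<otimes> inv g))" for x
  have \<theta>: "\<theta> x \<in> carrier G \<and> (\<forall>a\<in>A. \<alpha> (x \<otimes> a \<otimes> inv x) = \<theta> x \<otimes> \<alpha> a \<otimes> inv (\<theta> x))"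
    if "x \<in> carrier G" for x
  proof -
    have "\<exists>g. g \<in> carrier G \<and> (\<forall>a\<in>A. \<alpha> (x \<otimes> a \<otimes> inv x) = g \<otimes> \<alpha> a \<otimes> inv g)"
      using normalises[OF that] by blast
    then show ?thesis unfolding \<theta>_def by (rule someI_ex)
  qed
  have \<theta>_eqI: "\<theta> x = g"
    if "x \<in> carrier G" "g \<in> carrier G" "\<And>a. a \<in> A \<Longrightarrow> \<alpha> (x \<otimes> a \<otimes> inv x) = g \<otimes> \<alpha> a \<otimes> inv g" for x g
    using unique[of "\<theta> x" g] \<theta>[OF that(1)] that by metis
  have mult: "\<theta> (x \<otimes> y) = \<theta> x \<otimes> \<theta> y" if x: "x \<in> carrier G" and y: "y \<in> carrier G" for x y
  proof (rule \<theta>_eqI)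
    fix a assume a: "a \<in> A"
    show "\<alpha> (x \<otimes> y \<otimes> a \<otimes> inv (x \<otimes> y)) = \<theta> x \<otimes> \<theta> y \<otimes> \<alpha> a \<otimes> inv (\<theta> x \<otimes> \<theta> y)"
    proof -
      have "\<alpha> (x \<otimes> y \<otimes> a \<otimes> inv (x \<otimes> y)) = \<alpha> (x \<otimes> (y \<otimes> a \<otimes> inv y) \<otimes> inv x)"
        by (simp only: conj_mult[OF x y AG[OF a]])
      also have "\<dots> = \<theta> x \<otimes> \<alpha> (y \<otimes> a \<otimes> inv y) \<otimes> inv (\<theta> x)"
        using \<theta>[OF x] conjA[OF y a] by blast
      also have "\<alpha> (y \<otimes> a \<otimes> inv y) = \<theta> y \<otimes> \<alpha> a \<otimes> inv (\<theta> y)"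
        using \<theta>[OF y] a by blast
      finally show ?thesis
        using conj_mult[of "\<theta> x" "\<theta> y" "\<alpha> a"] \<theta>[OF x] \<theta>[OF y] AG[OF \<alpha>A[OF a]] by simp
    qed
  qed (use x y \<theta> in auto)
  have inj: "inj_on \<theta> (carrier G)"
  proof (rule inj_onI)
    fix x y assume x: "x \<in> carrier G" and y: "y \<in> carrier G" and eq: "\<theta> x = \<theta> y"
    have "x \<otimes> a \<otimes> inv x = y \<otimes> a \<otimes> inv y" if a: "a \<in> A" for a
      using \<theta>[OF x] \<theta>[OF y] eq a conjA[OF x a] conjA[OF y a] bij_betw_imp_inj_on[OF \<alpha>(1)]
      by (metis inj_onD)
    then have "x \<otimes> \<alpha> a \<otimes> inv x = y \<otimes> \<alpha> a \<otimes> inv y" if "a \<in> A" for a using \<alpha>A that by blast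
    then show "x = y" using unique[OF x y] by blast
  qed
  have "\<theta> ` carrier G \<subseteq> carrier G" using \<theta> by blast
  then have "bij_betw \<theta> (carrier G) (carrier G)"
    using inj endo_inj_surj[OF fin] by (simp add: bij_betw_def)
  then have auto: "restrict \<theta> (carrier G) \<in> auto G" using mult by (rule restrict_in_auto)
  have "\<theta> a = \<alpha> a" if a: "a \<in> A" for a
  proof (rule \<theta>_eqI)
    fix b assume b: "b \<in> A"
    have ia: "inv a \<in> A" using A a normal_imp_subgroup subgroup.m_inv_closed by metis
    have ab: "a \<otimes> b \<in> A" using A a b normal_imp_subgroup subgroup.m_closed by metis
    have one: "\<one> \<in> A" using A normal_imp_subgroup subgroup.one_closed by metis
    have \<alpha>G: "\<alpha> c \<in> carrier G" if "c \<in> A" for c using AG \<alpha>A that by blast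
    have "\<alpha> \<one> \<otimes> \<alpha> \<one> = \<alpha> \<one>" using \<alpha>(2)[OF one one] by simp
    then have "\<alpha> \<one> = \<one>" using \<alpha>G[OF one] by (simp add: r_cancel_one)
    then have "\<alpha> (inv a) \<otimes> \<alpha> a = \<one>" using \<alpha>(2)[OF ia a] AG[OF a] by simp
    then have "\<alpha> (inv a) = inv (\<alpha> a)" using inv_equality \<alpha>G a ia by metis
    then show "\<alpha> (a \<otimes> b \<otimes> inv a) = \<alpha> a \<otimes> \<alpha> b \<otimes> inv (\<alpha> a)"
      using \<alpha>(2)[OF ab ia] \<alpha>(2)[OF a b] by simp
  qed (use a AG \<alpha>A in auto)
  then show thesis using that[OF auto] AG by simp
qed

end

lemma (in group) displacement_of_identity:
  assumes "\<And>x. x \<in> carrier G \<Longrightarrow> \<psi> x = x"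
  shows "displacement G \<psi> = {\<one>}"
proof -
  have "(\<lambda>x. x \<otimes> inv (\<psi> x)) ` carrier G = {\<one>}"
    using assms by (auto simp: image_iff intro!: bexI[of _ \<one>])
  then show ?thesis
    unfolding displacement_def using generate_subgroup_incl[OF _ triv_subgroup, of "{\<one>}"] generate.one
    by (auto 0 3)
qed

section \<open>Automorphisms of the alternating group\<close>

lemma cyc_at:
  assumes d: "distinct [d, e, f]" and p: "p = cyc d e f" and u: "p u \<noteq> u"
  shows "distinct [u, p u, p (p u)]" "p = cyc u (p u) (p (p u))" "{u, p u, p (p u)} = {d, e, f}"
proof -
  have ne: "d \<noteq> e" "d \<noteq> f" "e \<noteq> f" using d by simp_all
  have v: "p d = e" "p e = f" "p f = d" using ne by (simp_all add: p cyc_apply)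
  have rot: "p = cyc e f d" "p = cyc f d e" using cyc_rotate[OF d] cyc_rotate[of e f d] d p by auto
  have "u = d \<or> u = e \<or> u = f" using u p cyc_apply(4) by metis
  then have "(distinct [u, p u, p (p u)] \<and> p = cyc u (p u) (p (p u))) \<and> {u, p u, p (p u)} = {d, e, f}"
  proof (elim disjE)
    assume "u = d" then show ?thesis using v d p by simp
  next
    assume "u = e" then show ?thesis using v d rot(1) by auto
  next
    assume "u = f" then show ?thesis using v d rot(2) by auto
  qed
  then show "distinct [u, p u, p (p u)]" "p = cyc u (p u) (p (p u))" "{u, p u, p (p u)} = {d, e, f}"
    by blast+
qed

lemma three_cycle_at:
  assumes "three_cycle S p" "p u \<noteq> u"
  shows "distinct [u, p u, p (p u)]" "p = cyc u (p u) (p (p u))" "{u, p u, p (p u)} \<subseteq> S"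
proof -
  obtain a b c where *: "distinct [a, b, c]" "{a, b, c} \<subseteq> S" "p = cyc a b c"
    using assms(1) unfolding three_cycle_def by blast
  show "distinct [u, p u, p (p u)]" "p = cyc u (p u) (p (p u))" "{u, p u, p (p u)} \<subseteq> S"
    using cyc_at[OF *(1,3) assms(2)] *(2) by blast+
qed

lemma three_cycle_moves: "three_cycle S p \<Longrightarrow> \<exists>u. p u \<noteq> u"
proof -
  assume "three_cycle S p"
  then obtain a b c where "distinct [a, b, c]" "p = cyc a b c" unfolding three_cycle_def by blast
  then have "p a \<noteq> a" by (auto simp: cyc_apply)
  then show ?thesis by blast
qed

lemma three_cycle_order: "three_cycle S p \<Longrightarrow> p \<noteq> id \<and> p \<circ> p \<circ> p = id"
  unfolding three_cycle_def by (elim exE conjE) (simp only: cyc_neq_id cyc_cube not_False_eq_True simp_thms)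

lemma three_cycle_in_alt_group: "three_cycle {1..n} p \<Longrightarrow> p \<in> carrier (alt_group n)"
  unfolding three_cycle_def using cyc_in_alt_group by blast

text \<open>
Disjoint 3-cycles have a product of order three. If the supports meet in a point \<open>a\<close>, write \<open>p = (a b c)\<close>
and \<open>q = (a e f)\<close>. Unless they share an arc or are inverse to each other, \<open>p q\<close> is a 3-cycle
or a 5-cycle, and following \<open>a\<close> or \<open>c\<close> shows that its square is not the identity.
\<close>

lemma common_arc:
  assumes p: "three_cycle S p" and q: "three_cycle S q"
    and inv: "(p \<circ> q) \<circ> (p \<circ> q) = id" and ne: "p \<circ> q \<noteq> id"
  shows "\<exists>u. p u \<noteq> u \<and> q u = p u"
proof -
  have pq: "p (q (p (q x))) = x" for x using inv by (simp add: fun_eq_iff)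
  have "\<exists>a. p a \<noteq> a \<and> q a \<noteq> a"
  proof (rule ccontr)
    assume disj: "\<not> ?thesis"
    obtain a where a: "p a \<noteq> a" using three_cycle_moves[OF p] by blast
    have "distinct [a, p a, p (p a)]" using three_cycle_at(1)[OF p a] .
    then have "p (p a) \<noteq> p a" "p (p a) \<noteq> a" by auto
    moreover from this have "q a = a" "q (p a) = p a" using disj a by blast+
    ultimately have "q a = a" "q (p a) = p a" "p (p a) \<noteq> a" by blast+
    then show False using pq[of a] by simp
  qed
  then obtain a where a: "p a \<noteq> a" "q a \<noteq> a" by blast
  define b c e f where "b = p a" and "c = p (p a)" and "e = q a" and "f = q (q a)"
  have p_eq: "p = cyc a b c" and q_eq: "q = cyc a e f"
    unfolding b_def c_def e_def f_def
    by (rule three_cycle_at(2)[OF p a(1)], rule three_cycle_at(2)[OF q a(2)])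
  have dp: "a \<noteq> b" "a \<noteq> c" "b \<noteq> c" and dq: "a \<noteq> e" "a \<noteq> f" "e \<noteq> f"
    using three_cycle_at(1)[OF p a(1)] three_cycle_at(1)[OF q a(2)]
    unfolding b_def c_def e_def f_def by simp_all
  have pv: "p a = b" "p b = c" "p c = a" "\<And>x. x \<noteq> a \<Longrightarrow> x \<noteq> b \<Longrightarrow> x \<noteq> c \<Longrightarrow> p x = x"
    unfolding p_eq using dp by (simp_all add: cyc_apply)
  have qv: "q a = e" "q e = f" "q f = a" "\<And>x. x \<noteq> a \<Longrightarrow> x \<noteq> e \<Longrightarrow> x \<noteq> f \<Longrightarrow> q x = x"
    unfolding q_eq using dq by (simp_all add: cyc_apply)
  consider "e = b" | "e = c" "f = b" | "e = c" "f \<noteq> b" | "e \<noteq> b" "e \<noteq> c" "f = b"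
    | "e \<noteq> b" "e \<noteq> c" "f = c" | "e \<noteq> b" "e \<noteq> c" "f \<noteq> b" "f \<noteq> c" by blast
  then show ?thesis
  proof cases
    case 1
    then show ?thesis using pv(1) qv(1) a(1) by metis
  next
    case 2
    then have "p \<circ> q = id" using cyc_inverse[of a b c] cyc_rotate[of b a c] dp p_eq q_eq by simp
    then show ?thesis using ne by blast
  next
    case 3
    have "q c = f" "q f = a" using 3 qv by simp_all
    moreover have "p f = f" using pv(4)[of f] dq 3 by metis
    ultimately show ?thesis using pq[of c] pv dp by metis
  next
    case 4
    have "p e = e" using pv(4)[of e] dq 4 by metis
    then have "p (q (p (q a))) = c" using qv pv 4 by simp
    then show ?thesis using pq[of a] dp by metis
  next
    case 5
    then show ?thesis using pv(3) qv(3) dp by metis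
  next
    case 6
    have "p e = e" "p f = f" using pv(4)[of e] pv(4)[of f] dq 6 by metis+
    then have "p (q (p (q a))) = f" using qv by simp
    then show ?thesis using pq[of a] dq by metis
  qed
qed

text \<open>
Let \<open>p = (a b x)\<close> and \<open>q = (a b y)\<close>. If \<open>r\<close> shares an arc with both but does not map \<open>a\<close> to \<open>b\<close>, then the
shared arcs are \<open>b \<mapsto> x\<close> and \<open>y \<mapsto> a\<close>, or \<open>b \<mapsto> y\<close> and \<open>x \<mapsto> a\<close>. In both cases \<open>r\<close> moves the four points
\<open>a\<close>, \<open>b\<close>, \<open>x\<close>, \<open>y\<close>.
\<close>

lemma common_arc_three:
  assumes p: "three_cycle S p" and q: "three_cycle S q" and r: "three_cycle S r"
    and pq: "p a \<noteq> a" "q a = p a" "p \<noteq> q"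
    and pr: "\<exists>u. p u \<noteq> u \<and> r u = p u" and qr: "\<exists>u. q u \<noteq> u \<and> r u = q u"
  shows "r a = p a"
proof (rule ccontr)
  assume nr: "r a \<noteq> p a"
  define b x y where "b = p a" and "x = p b" and "y = q b"
  have qa: "q a \<noteq> a" using pq by simp
  have p_eq: "p = cyc a b x" and dp: "distinct [a, b, x]"
    unfolding b_def x_def by (rule three_cycle_at(2)[OF p pq(1)], rule three_cycle_at(1)[OF p pq(1)])
  have q_eq: "q = cyc a b y" and dq: "distinct [a, b, y]"
    unfolding b_def y_def pq(2)[symmetric] by (rule three_cycle_at(2)[OF q qa], rule three_cycle_at(1)[OF q qa])
  have xy: "x \<noteq> y" using pq(3) p_eq q_eq by blast
  obtain d e f where r_eq: "r = cyc d e f" and dr: "distinct [d, e, f]"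
    using r unfolding three_cycle_def by blast
  have inj: "u = v" if "r u = r v" for u v
  proof -
    have "r (r (r w)) = w" for w using three_cycle_order[OF r] by (simp add: fun_eq_iff)
    then show ?thesis using arg_cong[OF that, of "\<lambda>w. r (r w)"] by simp
  qed
  have "\<exists>u\<in>{b, x}. r u = p u"
  proof -
    obtain u where u: "p u \<noteq> u" "r u = p u" using pr by blast
    then have "u \<in> {a, b, x}" using cyc_apply(4)[of u a b x] p_eq by blast
    moreover have "u \<noteq> a" using u(2) nr by blast
    ultimately show ?thesis using u(2) by blast
  qed
  moreover have "p b = x" "p x = a" unfolding p_eq using dp by (simp_all add: cyc_apply)
  ultimately have 1: "r b = x \<or> r x = a" by auto
  have "\<exists>u\<in>{b, y}. r u = q u"
  proof -
    obtain u where u: "q u \<noteq> u" "r u = q u" using qr by blast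
    then have "u \<in> {a, b, y}" using cyc_apply(4)[of u a b y] q_eq by blast
    moreover have "u \<noteq> a" using u(2) nr pq(2) by metis
    ultimately show ?thesis using u(2) by blast
  qed
  moreover have "q b = y" "q y = a" unfolding q_eq using dq by (simp_all add: cyc_apply)
  ultimately have 2: "r b = y \<or> r y = a" by auto
  have neq: "a \<noteq> b" "a \<noteq> x" "b \<noteq> x" "a \<noteq> y" "b \<noteq> y" using dp dq by auto
  have "r b = x \<and> r y = a \<or> r x = a \<and> r b = y" using 1 2 xy inj by metis
  then have "r a \<noteq> a" "r b \<noteq> b" "r x \<noteq> x" "r y \<noteq> y" using neq inj by metis+
  then have "{a, b, x, y} \<subseteq> {d, e, f}" using cyc_apply(4)[of _ d e f] unfolding r_eq by blast
  then have "card {a, b, x, y} \<le> card {d, e, f}" by (intro card_mono) auto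
  then show False using dp dq xy dr by auto
qed

text \<open>
For \<open>i \<noteq> j\<close> the product of \<open>(1 2 i)\<close> and \<open>(1 2 j)\<close> has order two, so the same holds for their images, which
therefore share an arc pairwise, and then share one common arc \<open>a \<mapsto> b\<close>. Thus the images are \<open>(a b g(i))\<close>, and
setting \<open>g(1) = a\<close> and \<open>g(2) = b\<close> gives a permutation \<open>g\<close>. Conjugation by \<open>g\<close> agrees with \<open>\<beta>\<close> on the
generators \<open>(1 2 i)\<close>.
\<close>

lemma three_cycle_preserving_is_conjugation:
  assumes n: "n \<ge> 4" and hom: "\<beta> \<in> hom (alt_group n) (alt_group n)"
    and inj: "inj_on \<beta> (carrier (alt_group n))"
    and cyc: "\<And>p. three_cycle {1..n} p \<Longrightarrow> three_cycle {1..n} (\<beta> p)"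
  obtains g where "g permutes {1..n}" "\<And>a. a \<in> carrier (alt_group n) \<Longrightarrow> \<beta> a = g \<circ> a \<circ> inv' g"
proof -
  let ?A = "carrier (alt_group n)"
  interpret S: group "sym_group n" by (rule sym_group_is_group)
  interpret A: group "alt_group n" by (rule alt_group_is_group)
  interpret \<beta>: group_hom "alt_group n" "alt_group n" \<beta>
    using hom by unfold_locales
  have mult: "\<beta> (a \<circ> b) = \<beta> a \<circ> \<beta> b" if "a \<in> ?A" "b \<in> ?A" for a b
    using hom_mult[OF hom that] by (simp add: alt_group_mult)
  have one: "\<beta> id = id" using \<beta>.hom_one by (simp add: alt_group_one)
  have compA: "a \<circ> b \<in> ?A" if "a \<in> ?A" "b \<in> ?A" for a b
    using A.m_closed[OF that] by (simp add: alt_group_mult)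
  have idA: "id \<in> ?A" using A.one_closed by (simp add: alt_group_one)
  define t :: "nat \<Rightarrow> nat \<Rightarrow> nat" where "t = cyc 1 2"
  define C where "C i = \<beta> (t i)" for i
  have t3: "three_cycle {1..n} (t i)" if "i \<in> {3..n}" for i
    unfolding three_cycle_def t_def by (rule exI[of _ 1], rule exI[of _ 2], rule exI[of _ i]) (use that in auto)
  have tA: "t i \<in> ?A" if "i \<in> {3..n}" for i using three_cycle_in_alt_group[OF t3[OF that]] .
  have t_inj: "i = j" if "t i = t j" "i \<in> {3..n}" "j \<in> {3..n}" for i j
  proof -
    have "t i 2 = t j 2" using that(1) by simp
    then show ?thesis by (simp add: t_def cyc_apply)
  qed
  have C3: "three_cycle {1..n} (C i)" if "i \<in> {3..n}" for i using cyc[OF t3[OF that]] by (simp add: C_def)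
  have C_inj: "i = j" if "C i = C j" "i \<in> {3..n}" "j \<in> {3..n}" for i j
    using inj_onD[OF inj, of "t i" "t j"] that tA t_inj by (simp add: C_def)
  have arc: "\<exists>u. C i u \<noteq> u \<and> C j u = C i u" if "i \<in> {3..n}" "j \<in> {3..n}" "i \<noteq> j" for i j
  proof (rule common_arc[OF C3 C3])
    have "(t i \<circ> t j) \<circ> (t i \<circ> t j) = id"
      using that by (auto simp: t_def cyc_def fun_eq_iff)
    then show "(C i \<circ> C j) \<circ> (C i \<circ> C j) = id"
      using mult[OF tA[OF that(1)] tA[OF that(2)]] mult[OF compA[OF tA[OF that(1)] tA[OF that(2)]] compA[OF tA[OF that(1)] tA[OF that(2)]]] one
      by (simp add: C_def)
    have "(t i \<circ> t j) 1 \<noteq> id 1"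
      using that by (simp add: t_def cyc_apply)
    then have "t i \<circ> t j \<noteq> id" by metis
    then have "\<beta> (t i \<circ> t j) \<noteq> \<beta> id" using inj_onD[OF inj] compA tA that idA by blast
    then show "C i \<circ> C j \<noteq> id" using mult tA that one by (simp add: C_def)
  qed (use that in auto)
  have mem34: "3 \<in> {3..n}" "4 \<in> {3..n}" using n by auto
  obtain a where a: "C 3 a \<noteq> a" "C 4 a = C 3 a" using arc[OF mem34] by auto
  define b where "b = C 3 a"
  have Ca: "C i a = b" if i: "i \<in> {3..n}" for i
  proof (cases "i = 3 \<or> i = 4")
    case True
    then show ?thesis using a by (auto simp: b_def)
  next
    case False
    have "C 3 \<noteq> C 4" using C_inj[of 3 4] mem34 by auto
    then show ?thesis
      using common_arc_three[OF C3[OF mem34(1)] C3[OF mem34(2)] C3[OF i] a] arc[OF mem34(1) i] arc[OF mem34(2) i] False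
      by (auto simp: b_def)
  qed
  have ab: "a \<noteq> b" using a by (simp add: b_def)
  have C_eq: "C i = cyc a b (C i b)" and C_dist: "distinct [a, b, C i b]" and C_sub: "{a, b, C i b} \<subseteq> {1..n}"
    if "i \<in> {3..n}" for i
  proof -
    have moved: "C i a \<noteq> a" using Ca[OF that] ab by simp
    show "C i = cyc a b (C i b)" "distinct [a, b, C i b]" "{a, b, C i b} \<subseteq> {1..n}"
      using three_cycle_at[OF C3[OF that] moved] unfolding Ca[OF that] by blast+
  qed
  define g where "g i = (if i = 1 then a else if i = 2 then b else if i \<in> {3..n} then C i b else i)" for i
  have g12: "g 1 = a" "g 2 = b" by (simp_all add: g_def)
  have g3: "g i = C i b" if "i \<in> {3..n}" for i using that by (auto simp: g_def)
  have split: "i = 1 \<or> i = 2 \<or> i \<in> {3..n}" if "i \<in> {1..n}" for i using that by auto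
  have g_inj: "inj_on g {1..n}"
  proof (rule inj_onI)
    fix i j assume i: "i \<in> {1..n}" and j: "j \<in> {1..n}" and eq: "g i = g j"
    have "C k b \<noteq> a" "C k b \<noteq> b" if "k \<in> {3..n}" for k using C_dist[OF that] by auto
    moreover have "k = l" if "k \<in> {3..n}" "l \<in> {3..n}" "C k b = C l b" for k l
      using C_eq[OF that(1)] C_eq[OF that(2)] that(3) C_inj[OF _ that(1,2)] by metis
    ultimately show "i = j" using split[OF i] split[OF j] eq g12 g3 ab by metis
  qed
  have g: "g permutes {1..n}"
  proof (rule inj_imp_permutes[OF g_inj])
    show "g i \<in> {1..n}" if "i \<in> {1..n}" for i
      using split[OF that] C_sub[of i] C_sub[OF mem34(1)] g12 g3[of i] by auto
    show "g i = i" if "i \<notin> {1..n}" for i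
      using that n by (auto simp: g_def)
  qed simp
  define H where "H = {x \<in> ?A. \<beta> x \<circ> g = g \<circ> x}"
  have permA: "x permutes {1..n}" if "x \<in> ?A" for x using that by (simp add: alt_group_carrier)
  have H: "subgroup H (sym_group n)"
  proof (rule S.subgroupI)
    show "H \<subseteq> carrier (sym_group n)" using permA by (auto simp: H_def sym_group_carrier)
    show "H \<noteq> {}" using idA one by (auto simp: H_def)
  next
    fix x assume "x \<in> H"
    then have x: "x \<in> ?A" "\<beta> x \<circ> g = g \<circ> x" by (simp_all add: H_def)
    have iA: "inv' x \<in> ?A" using alt_group_inv_closed[OF x(1)] .
    have xx: "inv' x \<circ> x = id" "x \<circ> inv' x = id" using permutes_inv_o[OF permA[OF x(1)]] by auto
    have "\<beta> (inv' x) \<circ> \<beta> x = id" using mult[OF iA x(1)] xx one by simp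
    then have "g \<circ> inv' x = \<beta> (inv' x) \<circ> (\<beta> x \<circ> g) \<circ> inv' x" by (simp add: comp_assoc[symmetric])
    also have "\<dots> = \<beta> (inv' x) \<circ> g" using x(2) xx(2) by (simp add: comp_assoc)
    finally show "inv\<^bsub>sym_group n\<^esub> x \<in> H"
      using iA permA[OF x(1)] by (simp add: H_def sym_group_carrier)
  next
    fix x y assume "x \<in> H" "y \<in> H"
    then have *: "x \<in> ?A" "\<beta> x \<circ> g = g \<circ> x" "y \<in> ?A" "\<beta> y \<circ> g = g \<circ> y" by (simp_all add: H_def)
    have "\<beta> (x \<circ> y) \<circ> g = \<beta> x \<circ> (\<beta> y \<circ> g)" using mult * by (simp add: comp_assoc)
    also have "\<dots> = (\<beta> x \<circ> g) \<circ> y" by (simp only: *(4) comp_assoc)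
    also have "\<dots> = g \<circ> (x \<circ> y)" by (simp only: *(2) comp_assoc)
    finally show "x \<otimes>\<^bsub>sym_group n\<^esub> y \<in> H"
      using compA[OF *(1,3)] by (simp add: H_def sym_group_mult)
  qed
  have "?A \<subseteq> H"
  proof (rule alt_group_subset_if_cycs_12[OF H])
    fix i assume i: "i \<in> {3..n}"
    have "\<beta> (t i) = cyc (g 1) (g 2) (g i)" using C_eq[OF i] g12 g3[OF i] by (simp add: C_def)
    then have "\<beta> (t i) \<circ> g = g \<circ> t i" using comp_cyc[OF permutes_inj[OF g]] by (simp add: t_def)
    then show "cyc 1 2 i \<in> H" using tA[OF i] by (simp add: H_def t_def)
  qed
  then have "\<beta> x = g \<circ> x \<circ> inv' g" if "x \<in> ?A" for x
  proof -
    have "\<beta> x \<circ> g = g \<circ> x" using that \<open>?A \<subseteq> H\<close> by (auto simp: H_def)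
    then have "g \<circ> x \<circ> inv' g = \<beta> x \<circ> (g \<circ> inv' g)" by (simp add: comp_assoc[symmetric])
    then show ?thesis using permutes_inv_o(1)[OF g] by simp
  qed
  then show thesis using that g by blast
qed

lemma alt_group_normal: "carrier (alt_group n) \<lhd> sym_group n"
  using group_hom.normal_kernel[OF sign_group_hom] unfolding alt_group_is_sign_kernel .

lemma finite_sym_group: "finite (carrier (sym_group n))"
  using finite_permutations[of "{1..n}"] by (simp add: sym_group_def)

lemma alt_group_subset: "carrier (alt_group n) \<subseteq> carrier (sym_group n)"
  by (auto simp: alt_group_carrier sym_group_carrier)

lemma finite_alt_group: "finite (carrier (alt_group n))"
  using finite_subset[OF alt_group_subset finite_sym_group] .

lemma alt_group_faithful:
  assumes "n \<ge> 4" "g \<in> carrier (sym_group n)"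
    and "\<And>a. a \<in> carrier (alt_group n) \<Longrightarrow> g \<otimes>\<^bsub>sym_group n\<^esub> a = a \<otimes>\<^bsub>sym_group n\<^esub> g"
  shows "g = \<one>\<^bsub>sym_group n\<^esub>"
proof -
  have "g = id"
  proof (rule centralizer_of_cycs_trivial)
    show "g permutes {1..n}" using assms(2) by (simp add: sym_group_carrier)
    show "g \<circ> cyc a b c = cyc a b c \<circ> g" if "distinct [a, b, c]" "{a, b, c} \<subseteq> {1..n}" for a b c
      using assms(3)[OF cyc_in_alt_group[OF that]] by (simp add: sym_group_mult)
  qed (use assms(1) in auto)
  then show ?thesis by (simp add: sym_group_one)
qed

lemma evenperm_comp_permutes:
  "p permutes {1..n::nat} \<Longrightarrow> q permutes {1..n} \<Longrightarrow> evenperm (p \<circ> q) \<longleftrightarrow> evenperm p = evenperm q"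
  by (intro evenperm_comp) (auto intro: permutes_imp_permutation)

text \<open>
Products of an odd permutation in \<open>H\<close> with the elements of \<open>A\<^sub>n\<close> exhaust the odd permutations.
\<close>

lemma subgroup_containing_alt_group:
  assumes H: "subgroup H (sym_group n)" and "carrier (alt_group n) \<subseteq> H"
  shows "H = carrier (alt_group n) \<or> H = carrier (sym_group n)"
proof (rule disjCI)
  assume ne: "H \<noteq> carrier (sym_group n)"
  have "x \<in> carrier (alt_group n)" if x: "x \<in> H" for x
  proof (rule ccontr)
    assume "x \<notin> carrier (alt_group n)"
    then have px: "x permutes {1..n}" "\<not> evenperm x"
      using subgroup_permutes[OF H x] by (simp_all add: alt_group_carrier)
    have "y \<in> H" if y: "y permutes {1..n}" for y
    proof (cases "evenperm y")
      case True
      then show ?thesis using y assms(2) by (auto simp: alt_group_carrier)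
    next
      case False
      have ix: "inv' x permutes {1..n}" using permutes_inv[OF px(1)] .
      have "\<not> evenperm (inv' x)"
        using evenperm_inv[of x] px permutes_imp_permutation[of "{1..n}" x] by simp
      then have "y \<circ> inv' x \<in> H"
        using assms(2) False evenperm_comp_permutes[OF y ix] permutes_compose[OF ix y]
        by (auto simp: alt_group_carrier)
      then have "(y \<circ> inv' x) \<circ> x \<in> H" using subgroup_comp_closed[OF H] x by blast
      then show ?thesis using permutes_inv_o(2)[OF px(1)] by (simp add: comp_assoc)
    qed
    then show False using ne subgroup.subset[OF H] by (auto simp: sym_group_carrier)
  qed
  then show "H = carrier (alt_group n)" using assms(2) by blast
qed

text \<open>
It suffices that \<open>\<beta> = \<alpha> \<circ> c\<^sub>x \<circ> \<alpha>\<^sup>-\<^sup>1\<close> maps 3-cycles to 3-cycles, where \<open>c\<^sub>x\<close> is conjugation by a permutation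
\<open>x\<close>. For \<open>n = 4\<close> this is a matter of orders. For \<open>n \<ge> 5\<close> and a 3-cycle \<open>c\<close>, the element \<open>d = \<alpha>\<^sup>-\<^sup>1(c)\<close> commutes
with an odd \<open>t\<close>; replacing \<open>x\<close> by \<open>x t\<close> if \<open>x\<close> is odd, the conjugation of \<open>d\<close> takes place inside \<open>A\<^sub>n\<close>,
where \<open>\<alpha>\<close> is multiplicative, and \<open>\<beta>(c)\<close> becomes a conjugate of \<open>c\<close>.
\<close>

lemma alt_group_automorphism_extends:
  assumes n: "n \<ge> 4" and bij: "bij_betw \<alpha> (carrier (alt_group n)) (carrier (alt_group n))"
    and hom: "\<alpha> \<in> hom (alt_group n) (alt_group n)"
  obtains \<theta> where "\<theta> \<in> auto (sym_group n)" "\<And>a. a \<in> carrier (alt_group n) \<Longrightarrow> \<theta> a = \<alpha> a"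
proof -
  let ?A = "carrier (alt_group n)"
  interpret S: group "sym_group n" by (rule sym_group_is_group)
  interpret A: group "alt_group n" by (rule alt_group_is_group)
  have mult: "\<alpha> (a \<circ> b) = \<alpha> a \<circ> \<alpha> b" if "a \<in> ?A" "b \<in> ?A" for a b
    using hom_mult[OF hom that] by (simp add: alt_group_mult)
  have \<alpha>A: "\<alpha> a \<in> ?A" if "a \<in> ?A" for a using bij that bij_betwE by blast
  have compA: "a \<circ> b \<in> ?A" if "a \<in> ?A" "b \<in> ?A" for a b
    using A.m_closed[OF that] by (simp add: alt_group_mult)
  have permA: "a permutes {1..n}" if "a \<in> ?A" for a using that by (simp add: alt_group_carrier)
  have idA: "id \<in> ?A" using A.one_closed by (simp add: alt_group_one)
  interpret \<alpha>: group_hom "alt_group n" "alt_group n" \<alpha>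
    using hom by unfold_locales
  have \<alpha>id: "\<alpha> id = id" using \<alpha>.hom_one by (simp add: alt_group_one)
  have \<alpha>inv: "\<alpha> (inv' a) = inv' (\<alpha> a)" if "a \<in> ?A" for a
    using \<alpha>.hom_inv[OF that] that \<alpha>A by (simp add: alt_group_inv_equality)
  have conjA: "x \<circ> a \<circ> inv' x \<in> ?A" if "x permutes {1..n}" "a \<in> ?A" for x a
    using permutes_conj_imp_mem[OF alt_group_normal that(2,1)] .
  show thesis
  proof (rule S.extend_automorphism_of_faithful[OF finite_sym_group alt_group_normal])
    fix x assume "x \<in> carrier (sym_group n)"
    then have x: "x permutes {1..n}" by (simp add: sym_group_carrier)
    define \<gamma> where "\<gamma> = inv_into ?A \<alpha>"
    have \<gamma>A: "\<gamma> a \<in> ?A" and \<alpha>\<gamma>: "\<alpha> (\<gamma> a) = a" if "a \<in> ?A" for a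
      using bij that bij_betwE[OF bij_betw_inv_into[OF bij]] bij_betw_inv_into_right[OF bij]
      by (simp_all add: \<gamma>_def)
    have \<gamma>\<alpha>: "\<gamma> (\<alpha> a) = a" if "a \<in> ?A" for a
      using bij_betw_inv_into_left[OF bij that] by (simp add: \<gamma>_def)
    have \<alpha>_eq: "a = b" if "\<alpha> a = \<alpha> b" "a \<in> ?A" "b \<in> ?A" for a b using that \<gamma>\<alpha> by metis
    define \<beta> where "\<beta> a = \<alpha> (x \<circ> \<gamma> a \<circ> inv' x)" for a
    have xx: "inv' x \<circ> (x \<circ> y) = y" for y :: "nat \<Rightarrow> nat"
      using permutes_inv_o(2)[OF x] by (simp add: comp_assoc[symmetric])
    have xx': "x \<circ> a \<circ> inv' x \<circ> (x \<circ> b \<circ> inv' x) = x \<circ> (a \<circ> b) \<circ> inv' x" for a b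
      using xx by (simp add: comp_assoc)
    have \<gamma>mult: "\<gamma> (a \<circ> b) = \<gamma> a \<circ> \<gamma> b" if "a \<in> ?A" "b \<in> ?A" for a b
    proof (rule \<alpha>_eq)
      show "\<alpha> (\<gamma> (a \<circ> b)) = \<alpha> (\<gamma> a \<circ> \<gamma> b)" using that by (simp add: mult \<gamma>A \<alpha>\<gamma> compA)
    qed (use that \<gamma>A compA in auto)
    have \<beta>A: "\<beta> a \<in> ?A" if "a \<in> ?A" for a using \<alpha>A conjA[OF x] \<gamma>A that by (simp add: \<beta>_def)
    have \<beta>hom: "\<beta> \<in> hom (alt_group n) (alt_group n)"
    proof (rule homI)
      fix a b assume a: "a \<in> ?A" and b: "b \<in> ?A"
      have "\<beta> (a \<circ> b) = \<alpha> (x \<circ> \<gamma> a \<circ> inv' x \<circ> (x \<circ> \<gamma> b \<circ> inv' x))"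
        using a b by (simp only: \<beta>_def \<gamma>mult xx')
      also have "\<dots> = \<beta> a \<circ> \<beta> b" using a b by (simp only: mult conjA[OF x] \<gamma>A \<beta>_def)
      finally show "\<beta> (a \<otimes>\<^bsub>alt_group n\<^esub> b) = \<beta> a \<otimes>\<^bsub>alt_group n\<^esub> \<beta> b" by (simp add: alt_group_mult)
    qed (rule \<beta>A)
    have \<beta>inj: "inj_on \<beta> ?A"
    proof (rule inj_onI)
      fix a b assume a: "a \<in> ?A" and b: "b \<in> ?A" and "\<beta> a = \<beta> b"
      then have "x \<circ> \<gamma> a \<circ> inv' x = x \<circ> \<gamma> b \<circ> inv' x"
        using \<alpha>_eq conjA[OF x] \<gamma>A by (simp add: \<beta>_def)
      then have "inv' x \<circ> (x \<circ> \<gamma> a \<circ> inv' x) \<circ> x = inv' x \<circ> (x \<circ> \<gamma> b \<circ> inv' x) \<circ> x" by simp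
      then have "\<gamma> a = \<gamma> b" using xx permutes_inv_o(2)[OF x] by (simp add: comp_assoc)
      then show "a = b" using \<alpha>\<gamma> a b by metis
    qed
    have \<beta>cyc: "three_cycle {1..n} (\<beta> c)" if c: "three_cycle {1..n} c" for c
    proof -
      have cA: "c \<in> ?A" using three_cycle_in_alt_group[OF c] .
      have c3: "c \<noteq> id" "c \<circ> c \<circ> c = id" using three_cycle_order[OF c] by auto
      show ?thesis
      proof (cases "n = 4")
        case True
        interpret \<beta>: group_hom "alt_group n" "alt_group n" \<beta>
          using \<beta>hom by unfold_locales
        have \<beta>id: "\<beta> id = id" using \<beta>.hom_one by (simp add: alt_group_one)
        have \<beta>mult: "\<beta> (a \<circ> b) = \<beta> a \<circ> \<beta> b" if "a \<in> ?A" "b \<in> ?A" for a b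
          using hom_mult[OF \<beta>hom that] by (simp add: alt_group_mult)
        have "\<beta> c \<noteq> id" using inj_onD[OF \<beta>inj _ cA idA] \<beta>id c3 by metis
        moreover have "\<beta> c \<circ> \<beta> c \<circ> \<beta> c = id"
          using \<beta>mult[OF cA cA] \<beta>mult[OF compA[OF cA cA] cA] c3 \<beta>id by simp
        ultimately show ?thesis
          using order_three_is_three_cycle[of "\<beta> c" "{1..n}"] permA[OF \<beta>A[OF cA]] True by simp
      next
        case False
        define d where "d = \<gamma> c"
        have dA: "d \<in> ?A" and \<alpha>d: "\<alpha> d = c" using \<gamma>A \<alpha>\<gamma> cA by (simp_all add: d_def)
        have "d \<noteq> id" using \<alpha>d c3 \<alpha>id by metis
        moreover have "d \<circ> d \<circ> d = id"
          using \<alpha>_eq[of "d \<circ> d \<circ> d" id] mult compA dA idA \<alpha>d c3 \<alpha>id by simp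
        ultimately obtain t where t: "t permutes {1..n}" "\<not> evenperm t" "t \<circ> d = d \<circ> t"
          using odd_centralizer_of_order_three[of d "{1..n}"] permA[OF dA] n False by auto
        obtain y where y: "y \<in> ?A" "y \<circ> d \<circ> inv' y = x \<circ> d \<circ> inv' x"
        proof (cases "evenperm x")
          case True
          then show thesis using that[of x] x by (simp add: alt_group_carrier)
        next
          case False
          have "x \<circ> t \<in> ?A"
            using False t evenperm_comp_permutes[OF x t(1)] permutes_compose[OF t(1) x]
            by (simp add: alt_group_carrier)
          moreover have "(x \<circ> t) \<circ> d \<circ> inv' (x \<circ> t) = x \<circ> d \<circ> inv' x"
          proof -
            have "inv' (x \<circ> t) = inv' t \<circ> inv' x"
              using o_inv_distrib[of x t] permutes_bij[OF x] permutes_bij[OF t(1)] by simp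
            then have "(x \<circ> t) \<circ> d \<circ> inv' (x \<circ> t) = x \<circ> (t \<circ> d) \<circ> (inv' t \<circ> inv' x)" by (simp add: comp_assoc)
            also have "\<dots> = x \<circ> d \<circ> (t \<circ> inv' t) \<circ> inv' x" by (simp add: t(3) comp_assoc)
            finally show ?thesis using permutes_inv_o(1)[OF t(1)] by simp
          qed
          ultimately show thesis using that by blast
        qed
        have "\<beta> c = \<alpha> (y \<circ> d \<circ> inv' y)" by (simp add: \<beta>_def d_def[symmetric] y(2))
        also have "\<dots> = \<alpha> y \<circ> c \<circ> inv' (\<alpha> y)"
          using mult compA y(1) dA alt_group_inv_closed[OF y(1)] \<alpha>inv[OF y(1)] \<alpha>d by simp
        finally have eq: "\<beta> c = \<alpha> y \<circ> c \<circ> inv' (\<alpha> y)" .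
        have py: "\<alpha> y permutes {1..n}" using permA[OF \<alpha>A[OF y(1)]] .
        obtain u v w where uvw: "distinct [u, v, w]" "{u, v, w} \<subseteq> {1..n}" "c = cyc u v w"
          using c unfolding three_cycle_def by blast
        have "\<beta> c = cyc (\<alpha> y u) (\<alpha> y v) (\<alpha> y w)" using eq conj_cyc[OF py] uvw(3) by simp
        moreover have "distinct [\<alpha> y u, \<alpha> y v, \<alpha> y w]"
          using uvw(1) by (simp add: inj_eq[OF permutes_inj[OF py]])
        moreover have "{\<alpha> y u, \<alpha> y v, \<alpha> y w} \<subseteq> {1..n}"
          using uvw(2) permutes_in_image[OF py] by blast
        ultimately show ?thesis unfolding three_cycle_def by blast
      qed
    qed
    obtain g where g: "g permutes {1..n}" "\<And>a. a \<in> ?A \<Longrightarrow> \<beta> a = g \<circ> a \<circ> inv' g"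
      using three_cycle_preserving_is_conjugation[OF n \<beta>hom \<beta>inj \<beta>cyc] by blast
    have "\<alpha> (x \<circ> a \<circ> inv' x) = g \<circ> \<alpha> a \<circ> inv' g" if "a \<in> ?A" for a
      using g(2)[OF \<alpha>A[OF that]] \<gamma>\<alpha>[OF that] by (simp add: \<beta>_def)
    then show "\<exists>g\<in>carrier (sym_group n). \<forall>a\<in>?A. \<alpha> (x \<otimes>\<^bsub>sym_group n\<^esub> a \<otimes>\<^bsub>sym_group n\<^esub> inv\<^bsub>sym_group n\<^esub> x) =
        g \<otimes>\<^bsub>sym_group n\<^esub> \<alpha> a \<otimes>\<^bsub>sym_group n\<^esub> inv\<^bsub>sym_group n\<^esub> g"
      using g(1) x by (intro bexI[of _ g]) (simp_all add: sym_group_mult sym_group_carrier)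
  next
    show "\<alpha> (a \<otimes>\<^bsub>sym_group n\<^esub> b) = \<alpha> a \<otimes>\<^bsub>sym_group n\<^esub> \<alpha> b" if "a \<in> ?A" "b \<in> ?A" for a b
      using mult[OF that] by (simp add: sym_group_mult)
    show "g = \<one>\<^bsub>sym_group n\<^esub>" if "g \<in> carrier (sym_group n)"
      "\<And>a. a \<in> ?A \<Longrightarrow> g \<otimes>\<^bsub>sym_group n\<^esub> a = a \<otimes>\<^bsub>sym_group n\<^esub> g" for g
      using alt_group_faithful[OF n that] .
  qed (use bij that in auto)
qed

text \<open>
The 3-cycles are exactly the elements of order three, so \<open>\<psi>\<close> permutes them and preserves the subgroup
\<open>A\<^sub>4\<close> that they generate. On \<open>A\<^sub>4\<close> it is conjugation by some \<open>\<sigma>\<close>, and \<open>A\<^sub>4\<close> has trivial centralizer.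
\<close>

lemma sym_4_automorphism_inner:
  assumes \<psi>: "\<psi> \<in> auto (sym_group 4)"
  obtains \<sigma> where "\<sigma> permutes {1..4}" "\<And>x. x permutes {1..4} \<Longrightarrow> \<psi> x = \<sigma> \<circ> x \<circ> inv' \<sigma>"
proof -
  let ?A = "carrier (alt_group 4)"
  interpret S: group "sym_group 4" by (rule sym_group_is_group)
  have mult: "\<psi> (a \<circ> b) = \<psi> a \<circ> \<psi> b" if "a permutes {1..4}" "b permutes {1..4}" for a b
    using S.auto_mult[OF \<psi>] that by (simp add: sym_group_mult sym_group_carrier)
  have perm: "\<psi> a permutes {1..4}" if "a permutes {1..4}" for a
    using S.auto_closed[OF \<psi>] that by (simp add: sym_group_carrier)
  have \<psi>id: "\<psi> id = id" using S.auto_one[OF \<psi>] by (simp add: sym_group_one)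
  have inj: "a = b" if "\<psi> a = \<psi> b" "a permutes {1..4}" "b permutes {1..4}" for a b
    using inj_onD[OF bij_betw_imp_inj_on[OF S.auto_bij[OF \<psi>]], of a b] that by (simp add: sym_group_carrier)
  have permA: "a permutes {1..4}" if "a \<in> ?A" for a using that by (simp add: alt_group_carrier)
  have cyc: "three_cycle {1..4} (\<psi> c)" if c: "three_cycle {1..4} c" for c
  proof -
    have pc: "c permutes {1..4}" using permA[OF three_cycle_in_alt_group[OF c]] .
    have c3: "c \<noteq> id" "c \<circ> c \<circ> c = id" using three_cycle_order[OF c] by auto
    have "\<psi> c \<noteq> id" using inj[of c id] c3(1) \<psi>id pc by auto
    moreover have "\<psi> c \<circ> \<psi> c \<circ> \<psi> c = id"
      using mult[OF pc pc] mult[OF permutes_compose[OF pc pc] pc] c3(2) \<psi>id by simp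
    ultimately show ?thesis
      using order_three_is_three_cycle[of "\<psi> c" "{1..4}"] perm[OF pc] by simp
  qed
  define H where "H = {x \<in> carrier (sym_group 4). \<psi> x \<in> ?A}"
  have "?A \<subseteq> H"
  proof (rule alt_group_subset_if_cycs)
    show "subgroup H (sym_group 4)"
    proof (rule S.subgroupI)
      have "id \<in> H" using \<psi>id subgroup.one_closed[OF alt_group_is_subgroup[of 4]]
        by (simp add: H_def sym_group_one sym_group_carrier)
      then show "H \<noteq> {}" by blast
      show "inv\<^bsub>sym_group 4\<^esub> x \<in> H" if "x \<in> H" for x
        using that subgroup.m_inv_closed[OF alt_group_is_subgroup[of 4], of "\<psi> x"] S.auto_inv[OF \<psi>, of x]
          S.inv_closed[of x] by (simp add: H_def del: sym_group_inv_equality)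
      show "x \<otimes>\<^bsub>sym_group 4\<^esub> y \<in> H" if "x \<in> H" "y \<in> H" for x y
        using that subgroup.m_closed[OF alt_group_is_subgroup[of 4]] S.auto_mult[OF \<psi>] by (simp add: H_def)
    qed (auto simp: H_def)
    fix a b c :: nat assume *: "distinct [a, b, c]" "{a, b, c} \<subseteq> {1..4}"
    then have "three_cycle {1..4} (cyc a b c)" unfolding three_cycle_def by blast
    then show "cyc a b c \<in> H"
      using cyc three_cycle_in_alt_group permA by (simp add: H_def sym_group_carrier)
  qed
  then have \<psi>A: "\<psi> a \<in> ?A" if "a \<in> ?A" for a using that by (auto simp: H_def)
  have hom: "\<psi> \<in> hom (alt_group 4) (alt_group 4)"
    using \<psi>A mult permA by (intro homI) (simp_all add: alt_group_mult)
  have injA: "inj_on \<psi> ?A" using inj permA by (intro inj_onI) blast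
  obtain \<sigma> where \<sigma>: "\<sigma> permutes {1..4}" "\<And>a. a \<in> ?A \<Longrightarrow> \<psi> a = \<sigma> \<circ> a \<circ> inv' \<sigma>"
    using three_cycle_preserving_is_conjugation[OF _ hom injA cyc] by auto
  have s\<sigma>: "inv' \<sigma> \<circ> (\<sigma> \<circ> y) = y" for y :: "nat \<Rightarrow> nat"
      using permutes_inv_o(2)[OF \<sigma>(1)] by (simp add: comp_assoc[symmetric])
  have c_hom: "(\<lambda>x. \<sigma> \<circ> x \<circ> inv' \<sigma>) \<in> hom (sym_group 4) (sym_group 4)"
    using \<sigma>(1) by (intro homI)
      (simp_all add: sym_group_mult sym_group_carrier comp_assoc s\<sigma> permutes_compose permutes_inv)
  have "\<psi> x = \<sigma> \<circ> x \<circ> inv' \<sigma>" if "x permutes {1..4}" for x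
  proof (rule S.auto_eq_if_eq_on_faithful[OF alt_group_normal _ S.auto_hom[OF \<psi>] c_hom \<sigma>(2)])
    show "\<psi> ` ?A = ?A"
      using endo_inj_surj[OF finite_alt_group _ injA] \<psi>A by blast
    show "g = \<one>\<^bsub>sym_group 4\<^esub>" if "g \<in> carrier (sym_group 4)"
      "\<And>a. a \<in> ?A \<Longrightarrow> g \<otimes>\<^bsub>sym_group 4\<^esub> a = a \<otimes>\<^bsub>sym_group 4\<^esub> g" for g
      using alt_group_faithful[OF _ that] by simp
  qed (use that in \<open>simp_all add: sym_group_carrier\<close>)
  then show thesis using that \<sigma>(1) by blast
qed

section \<open>Generalized Alexander quandles of symmetric groups\<close>

text \<open>
Both \<open>x\<close> and \<open>x a\<close> are odd, hence involutions, and \<open>(x a)\<^sup>-\<^sup>1 = x a\<close> is the claim.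
\<close>

lemma odd_inverts_alt_group:
  assumes "n \<le> 3" "x permutes {1..n}" "\<not> evenperm x" "a \<in> carrier (alt_group n)"
  shows "x \<circ> a = inv' a \<circ> x"
proof -
  have a: "a permutes {1..n}" "evenperm a" using assms(4) by (simp_all add: alt_group_carrier)
  have "\<not> evenperm (x \<circ> a)" using evenperm_comp_permutes[OF assms(2) a(1)] assms(3) a(2) by simp
  then have "(x \<circ> a) \<circ> (x \<circ> a) = id"
    using odd_square_eq_id[OF permutes_compose[OF a(1) assms(2)]] assms(1) by simp
  moreover have xx: "x \<circ> x = id" using odd_square_eq_id[OF assms(2,3)] assms(1) by simp
  ultimately have "inv' (x \<circ> a) = x \<circ> a" by (metis inv_unique_comp)
  moreover have "inv' (x \<circ> a) = inv' a \<circ> inv' x"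
    using o_inv_distrib permutes_bij[OF assms(2)] permutes_bij[OF a(1)] by blast
  moreover have "inv' x = x" using xx by (metis inv_unique_comp)
  ultimately show ?thesis by simp
qed

text \<open>
Equivariance gives multiplicativity when the left factor is even. For odd \<open>x\<close> and even \<open>a\<close>, rewriting
\<open>x a = a\<^sup>-\<^sup>1 x\<close> before and after applying \<open>f\<close> moves the even factor to the left; an odd right factor is
\<open>x\<close> times an even one.
\<close>

lemma alt_equivariant_is_hom:
  assumes n: "n \<le> 3" and f: "bij_betw f (carrier (sym_group n)) (carrier (sym_group n))"
    and fA: "f ` carrier (alt_group n) = carrier (alt_group n)"
    and eqv: "\<And>a x. a \<in> carrier (alt_group n) \<Longrightarrow> x permutes {1..n} \<Longrightarrow> f (a \<circ> x) = f a \<circ> f x"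
    and x: "x permutes {1..n}" and y: "y permutes {1..n}"
  shows "f (x \<circ> y) = f x \<circ> f y"
proof (cases "evenperm x")
  case True
  then show ?thesis using eqv[of x y] x y by (simp add: alt_group_carrier)
next
  case odd: False
  let ?A = "carrier (alt_group n)"
  have fp: "f z permutes {1..n}" if "z permutes {1..n}" for z
    using bij_betwE[OF f] that by (simp add: sym_group_carrier)
  have odd_f: "\<not> evenperm (f z)" if z: "z permutes {1..n}" "\<not> evenperm z" for z
  proof
    assume "evenperm (f z)"
    then have "f z \<in> f ` ?A" using fp[OF z(1)] fA by (simp add: alt_group_carrier)
    then obtain a where a: "a \<in> ?A" "f z = f a" by blast
    then have "z = a"
      using inj_onD[OF bij_betw_imp_inj_on[OF f], of z a] z(1) by (simp add: sym_group_carrier alt_group_carrier)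
    then show False using a(1) z(2) by (simp add: alt_group_carrier)
  qed
  have idA: "id \<in> ?A" by (simp add: alt_group_carrier)
  have f1: "f id = id"
  proof -
    have "f id \<circ> f id = f id" using eqv[OF idA permutes_id] by simp
    then have "inv' (f id) \<circ> (f id \<circ> f id) = inv' (f id) \<circ> f id" by simp
    then show ?thesis using permutes_inv_o(2)[OF fp[OF permutes_id]] by (simp add: comp_assoc[symmetric])
  qed
  have f_inv: "f (inv' a) = inv' (f a)" if a: "a \<in> ?A" for a
  proof -
    have pa: "a permutes {1..n}" using a by (simp add: alt_group_carrier)
    have "f (inv' a) \<circ> f a = id"
      using eqv[OF alt_group_inv_closed[OF a] pa] permutes_inv_o(2)[OF pa] f1 by simp
    then have "f (inv' a) \<circ> (f a \<circ> inv' (f a)) = inv' (f a)" by (simp add: comp_assoc[symmetric])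
    then show ?thesis using permutes_inv_o(1)[OF fp[OF pa]] by simp
  qed
  have fA': "f a \<in> ?A" if "a \<in> ?A" for a using fA that by blast
  have even_right: "f (x \<circ> a) = f x \<circ> f a" if a: "a \<in> ?A" for a
  proof -
    have "f (x \<circ> a) = inv' (f a) \<circ> f x"
      using odd_inverts_alt_group[OF n x odd a] eqv[OF alt_group_inv_closed[OF a] x] f_inv[OF a] by simp
    also have "\<dots> = f x \<circ> f a"
      using odd_inverts_alt_group[OF n fp[OF x] odd_f[OF x odd] fA'[OF a]] by simp
    finally show ?thesis .
  qed
  show ?thesis
  proof (cases "evenperm y")
    case True
    then show ?thesis using even_right y by (simp add: alt_group_carrier)
  next
    case False
    have xx: "x \<circ> x = id" using odd_square_eq_id[OF x odd] n by simp
    have fxx: "f x \<circ> f x = id" using odd_square_eq_id[OF fp[OF x] odd_f[OF x odd]] n by simp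
    define a where "a = x \<circ> y"
    have a: "a \<in> ?A"
      using evenperm_comp_permutes[OF x y] odd False permutes_compose[OF y x] by (simp add: a_def alt_group_carrier)
    have y_eq: "y = x \<circ> a" using xx by (simp add: a_def comp_assoc[symmetric])
    have "f x \<circ> f y = (f x \<circ> f x) \<circ> f a" using even_right[OF a] y_eq by (simp add: comp_assoc)
    then show ?thesis using fxx by (simp add: a_def)
  qed
qed

lemma displacement_without_alt_group_involutive:
  assumes \<psi>: "\<psi> \<in> auto (sym_group n)" and nA: "\<not> carrier (alt_group n) \<subseteq> displacement (sym_group n) \<psi>"
    and "p \<in> displacement (sym_group n) \<psi>"
  shows "p \<circ> p = id"
proof (cases "p = id")
  case False
  then show ?thesis
    using alt_group_subset_normal_subgroup[OF group.displacement_normal[OF sym_group_is_group \<psi>] assms(3)] nA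
    by auto
qed simp

text \<open>
For \<open>\<psi>\<close> conjugation by \<open>\<sigma>\<close>, the generators of the displacement subgroup are the commutators of \<open>\<sigma>\<close>. If
none of them is a 3-cycle, then \<open>\<sigma>\<close> is a fixed-point-free involution.
\<close>

lemma small_displacement_is_fpf_conjugation:
  assumes \<psi>: "\<psi> \<in> auto (sym_group 4)" and ne: "\<not> displacement (sym_group 4) \<psi> \<subseteq> {id}"
    and nA: "\<not> carrier (alt_group 4) \<subseteq> displacement (sym_group 4) \<psi>"
  obtains \<sigma> where "\<sigma> permutes {1..4}" "\<forall>x\<in>{1..4}. \<sigma> x \<noteq> x" "\<forall>x. \<sigma> (\<sigma> x) = x"
    "\<And>x. x permutes {1..4} \<Longrightarrow> \<psi> x = \<sigma> \<circ> x \<circ> inv' \<sigma>"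
proof -
  interpret S: group "sym_group 4" by (rule sym_group_is_group)
  obtain \<sigma> where \<sigma>: "\<sigma> permutes {1..4}" and \<psi>_eq: "\<And>x. x permutes {1..4} \<Longrightarrow> \<psi> x = \<sigma> \<circ> x \<circ> inv' \<sigma>"
    using sym_4_automorphism_inner[OF \<psi>] by blast
  have "\<sigma> \<noteq> id"
  proof
    assume "\<sigma> = id"
    then have "displacement (sym_group 4) \<psi> = {\<one>\<^bsub>sym_group 4\<^esub>}"
      using S.displacement_of_identity[of \<psi>] \<psi>_eq by (simp add: sym_group_carrier)
    then show False using ne by (simp add: sym_group_one)
  qed
  moreover have False
    if t: "t permutes {1..4}" and d: "distinct [a, b, c]" "{a, b, c} \<subseteq> {1..4}"
      and eq: "t \<circ> \<sigma> \<circ> inv' t \<circ> inv' \<sigma> = cyc a b c" for t a b c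
  proof -
    have perm_conj: "\<sigma> \<circ> t \<circ> inv' \<sigma> permutes {1..4}"
      using \<sigma> t by (intro permutes_compose permutes_inv)
    have "inv' (\<sigma> \<circ> t \<circ> inv' \<sigma>) = \<sigma> \<circ> inv' t \<circ> inv' \<sigma>"
    proof (rule inv_unique_comp)
      have 1: "inv' \<sigma> \<circ> (\<sigma> \<circ> y) = y" "t \<circ> (inv' t \<circ> y) = y" "inv' t \<circ> (t \<circ> y) = y" for y :: "nat \<Rightarrow> nat"
        using permutes_inv_o[OF \<sigma>] permutes_inv_o[OF t] by (simp_all add: comp_assoc[symmetric])
      show "\<sigma> \<circ> t \<circ> inv' \<sigma> \<circ> (\<sigma> \<circ> inv' t \<circ> inv' \<sigma>) = id" "\<sigma> \<circ> inv' t \<circ> inv' \<sigma> \<circ> (\<sigma> \<circ> t \<circ> inv' \<sigma>) = id"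
        using permutes_inv_o(1)[OF \<sigma>] by (simp_all only: comp_assoc 1)
    qed
    then have "t \<circ> inv' (\<psi> t) = cyc a b c"
      using eq by (simp add: \<psi>_eq[OF t] comp_assoc)
    moreover have "t \<circ> inv' (\<psi> t) \<in> displacement (sym_group 4) \<psi>"
      using S.displacement_mem[of t \<psi>] t perm_conj by (simp add: \<psi>_eq sym_group_carrier sym_group_mult)
    ultimately show False
      using alt_group_subset_if_cyc[OF S.displacement_normal[OF \<psi>] _ d] nA by simp
  qed
  ultimately have "\<forall>x\<in>{1..4}. \<sigma> x \<noteq> x" "\<forall>x. \<sigma> (\<sigma> x) = x"
    using three_cycle_commutator_or_fpf_involution[OF \<sigma>] by blast+
  then show thesis using that \<sigma> \<psi>_eq by blast
qed

lemma conjugate_if_fpf_conjugations: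
  assumes \<psi>: "\<psi> \<in> auto (sym_group 4)" and \<psi>': "\<psi>' \<in> auto (sym_group 4)"
    and \<sigma>: "\<sigma> permutes {1..4}" "\<forall>x\<in>{1..4}. \<sigma> x \<noteq> x" "\<forall>x. \<sigma> (\<sigma> x) = x"
    and \<psi>_eq: "\<And>x. x permutes {1..4} \<Longrightarrow> \<psi> x = \<sigma> \<circ> x \<circ> inv' \<sigma>"
    and \<tau>: "\<tau> permutes {1..4}" "\<forall>x\<in>{1..4}. \<tau> x \<noteq> x" "\<forall>x. \<tau> (\<tau> x) = x"
    and \<psi>'_eq: "\<And>x. x permutes {1..4} \<Longrightarrow> \<psi>' x = \<tau> \<circ> x \<circ> inv' \<tau>"
  shows "conjugate_in (AutoGroup (sym_group 4)) \<psi> \<psi>'"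
proof -
  interpret S: group "sym_group 4" by (rule sym_group_is_group)
  obtain g where g: "g permutes {1..4}" "g \<circ> \<sigma> = \<tau> \<circ> g"
    using fpf_involutions_conjugate[OF \<sigma> \<tau>] by blast
  let ?c = "\<lambda>x. g \<circ> x \<circ> inv' g"
  have gg: "inv' g \<circ> (g \<circ> y) = y" "g \<circ> (inv' g \<circ> y) = y" for y :: "nat \<Rightarrow> nat"
    using permutes_inv_o[OF g(1)] by (simp_all add: comp_assoc[symmetric])
  have gg': "g \<circ> inv' g = id" "inv' g \<circ> g = id" using permutes_inv_o[OF g(1)] by auto
  have c_perm: "?c x permutes {1..4}" if "x permutes {1..4}" for x
    using g(1) that by (intro permutes_compose permutes_inv)
  have "bij_betw ?c (carrier (sym_group 4)) (carrier (sym_group 4))"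
  proof (rule bij_betwI[where g = "\<lambda>x. inv' g \<circ> x \<circ> g"])
    show "?c \<in> carrier (sym_group 4) \<rightarrow> carrier (sym_group 4)"
      using c_perm by (simp add: sym_group_carrier)
    show "(\<lambda>x. inv' g \<circ> x \<circ> g) \<in> carrier (sym_group 4) \<rightarrow> carrier (sym_group 4)"
      using g(1) by (auto simp: sym_group_carrier intro!: permutes_compose permutes_inv)
  qed (simp_all add: comp_assoc gg gg')
  then have \<theta>: "restrict ?c (carrier (sym_group 4)) \<in> auto (sym_group 4)"
    by (rule S.restrict_in_auto) (simp add: sym_group_mult comp_assoc gg)
  have "?c (\<psi> x) = \<psi>' (?c x)" if x: "x permutes {1..4}" for x
  proof -
    have "inv' (g \<circ> \<sigma>) = inv' (\<tau> \<circ> g)" using g(2) by simp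
    then have inv_eq: "inv' \<sigma> \<circ> inv' g = inv' g \<circ> inv' \<tau>"
      using o_inv_distrib permutes_bij[OF \<sigma>(1)] permutes_bij[OF \<tau>(1)] permutes_bij[OF g(1)] by metis
    have "?c (\<psi> x) = (g \<circ> \<sigma>) \<circ> x \<circ> (inv' \<sigma> \<circ> inv' g)" by (simp add: \<psi>_eq[OF x] comp_assoc)
    also have "\<dots> = \<tau> \<circ> ?c x \<circ> inv' \<tau>" by (simp only: g(2) inv_eq comp_assoc)
    finally show ?thesis by (simp only: \<psi>'_eq[OF c_perm[OF x]])
  qed
  then have "\<forall>x\<in>carrier (sym_group 4). restrict ?c (carrier (sym_group 4)) (\<psi> x) =
      \<psi>' (restrict ?c (carrier (sym_group 4)) x)"
    using S.auto_closed[OF \<psi>] by (simp add: sym_group_carrier)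
  then show ?thesis using S.conjugate_in_AutoGroup_iff[OF \<psi> \<psi>'] \<theta> by blast
qed

text \<open>
The case distinction on the displacement subgroups. Containing \<open>A\<^sub>n\<close> is a property shared by \<open>P\<close> and \<open>P'\<close>:
if only one of them has it, then all elements of the other one have trivial square, whereas a 3-cycle
has order three.
\<close>

lemma conjugate_if_pointed_iso:
  assumes \<psi>: "\<psi> \<in> auto (sym_group n)" and \<psi>': "\<psi>' \<in> auto (sym_group n)"
    and f: "group.pointed_iso (sym_group n) \<psi> \<psi>' f"
  shows "conjugate_in (AutoGroup (sym_group n)) \<psi> \<psi>'"
proof -
  let ?S = "carrier (sym_group n)" and ?A = "carrier (alt_group n)"
  let ?P = "displacement (sym_group n) \<psi>" and ?P' = "displacement (sym_group n) \<psi>'"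
  interpret S: group "sym_group n" by (rule sym_group_is_group)
  have f_bij: "bij_betw f ?S ?S" and f1: "f id = id" and fP: "f ` ?P = ?P'"
    and f\<psi>: "\<And>x. x \<in> ?S \<Longrightarrow> f (\<psi> x) = \<psi>' (f x)"
    and f_mult: "\<And>p x. p \<in> ?P \<Longrightarrow> x \<in> ?S \<Longrightarrow> f (p \<circ> x) = f p \<circ> f x"
    using f unfolding S.pointed_iso_def by (simp_all add: sym_group_one sym_group_mult)
  have f_inj: "inj_on f ?S" using f_bij by (rule bij_betw_imp_inj_on)
  have N: "?P \<lhd> sym_group n" and N': "?P' \<lhd> sym_group n"
    using S.displacement_normal \<psi> \<psi>' by auto
  have sub: "subgroup ?P (sym_group n)" and sub': "subgroup ?P' (sym_group n)"
    using N N' by (auto intro: normal_imp_subgroup)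
  have PS: "?P \<subseteq> ?S" and P'S: "?P' \<subseteq> ?S" using sub sub' by (auto dest: subgroup.subset)
  have idS: "id \<in> ?S" by (simp add: sym_group_carrier)
  have idP: "id \<in> ?P" using subgroup.one_closed[OF sub] by (simp add: sym_group_one)
  note conj_iff = S.conjugate_in_AutoGroup_iff[OF \<psi> \<psi>']
  have conj_if_hom: ?thesis
    if "\<And>x y. x \<in> ?S \<Longrightarrow> y \<in> ?S \<Longrightarrow> f (x \<circ> y) = f x \<circ> f y"
  proof -
    have "restrict f ?S \<in> auto (sym_group n)"
      using f_bij that by (intro S.restrict_in_auto) (simp_all add: sym_group_mult)
    moreover have "\<forall>x\<in>?S. restrict f ?S (\<psi> x) = \<psi>' (restrict f ?S x)"
      using f\<psi> S.auto_closed[OF \<psi>] by simp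
    ultimately show ?thesis using conj_iff by blast
  qed
  show ?thesis
  proof (cases "?P \<subseteq> {id}")
    case True
    then have "?P' \<subseteq> {id}" using image_mono[OF True, of f] fP f1 by simp
    then have "\<psi> x = x" "\<psi>' x = x" if "x \<in> ?S" for x
      using S.displacement_trivial_imp_id \<psi> \<psi>' True that by (simp_all add: sym_group_one)
    then show ?thesis using conj_iff \<psi> by (metis (no_types, lifting))
  next
    case nontriv: False
    show ?thesis
    proof (cases "?A \<subseteq> ?P")
      case AP: True
      have "?A \<subseteq> ?P'"
      proof (rule ccontr)
        assume nA': "\<not> ?A \<subseteq> ?P'"
        have "n = 4"
        proof -
          obtain p where "p \<in> ?P" "p \<noteq> id" using nontriv by blast
          then have "f p \<in> ?P'" "f p \<noteq> id"
            using fP inj_onD[OF f_inj, of p id] PS idS f1 by auto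
          then show ?thesis using alt_group_subset_normal_subgroup[OF N'] nA' by blast
        qed
        define c :: "nat \<Rightarrow> nat" where "c = cyc 1 2 3"
        have cP: "c \<in> ?P" using cyc_in_alt_group[of 1 2 3 n] AP \<open>n = 4\<close> by (auto simp: c_def)
        then have "f (c \<circ> c) = f c \<circ> f c" using f_mult PS by blast
        also have "\<dots> = id" using displacement_without_alt_group_involutive[OF \<psi>' nA'] fP cP by blast
        finally have "c \<circ> c = id"
          using inj_onD[OF f_inj, of "c \<circ> c" id] subgroup_comp_closed[OF sub cP cP] PS idS f1 by auto
        moreover have "c \<circ> c \<noteq> id" by (simp add: c_def cyc_square_neq_id)
        ultimately show False by blast
      qed
      then consider "?P = ?S" | "?P = ?A" "?P' = ?A" | "?P = ?A" "?P' = ?S"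
        using subgroup_containing_alt_group[OF sub AP] subgroup_containing_alt_group[OF sub'] by blast
      then show ?thesis
      proof cases
        case 1
        then show ?thesis using conj_if_hom f_mult by simp
      next
        case 3
        then have "f ` ?P = f ` ?S" using fP f_bij by (simp add: bij_betw_def)
        then have "?P = ?S" using inj_on_image_eq_iff[OF f_inj PS] by blast
        then show ?thesis using conj_if_hom f_mult by simp
      next
        case 2
        have fA: "f ` ?A = ?A" using fP 2 by simp
        show ?thesis
        proof (cases "n \<le> 3")
          case True
          then show ?thesis
            using conj_if_hom alt_equivariant_is_hom[OF True f_bij fA] f_mult 2 by (simp add: sym_group_carrier)
        next
          case False
          then have n: "n \<ge> 4" by simp
          have AS: "?A \<subseteq> ?S" by (rule alt_group_subset)
          have fA_bij: "bij_betw f ?A ?A" using fA inj_on_subset[OF f_inj AS] by (simp add: bij_betw_def)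
          have f_hom: "f \<in> hom (alt_group n) (alt_group n)"
            using f_mult 2(1) fA AS by (intro homI) (auto simp: alt_group_mult)
          obtain \<theta> where \<theta>: "\<theta> \<in> auto (sym_group n)" and \<theta>f: "\<And>a. a \<in> ?A \<Longrightarrow> \<theta> a = f a"
            using alt_group_automorphism_extends[OF n fA_bij f_hom] by blast
          have \<psi>A: "\<psi> a \<in> ?A" if "a \<in> ?A" for a
            using S.auto_preserves_if_displacement_le[OF \<psi> _ alt_group_is_subgroup that] 2(1) by simp
          have \<psi>A_onto: "\<psi> ` ?A = ?A"
            using endo_inj_surj[OF finite_alt_group] \<psi>A inj_on_subset[OF bij_betw_imp_inj_on[OF S.auto_bij[OF \<psi>]] AS]
            by blast
          have "(\<theta> \<circ> \<psi>) x = (\<psi>' \<circ> \<theta>) x" if x: "x \<in> ?S" for x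
          proof (rule S.auto_eq_if_eq_on_faithful[OF alt_group_normal _ _ _ _ _ x])
            show "g = \<one>\<^bsub>sym_group n\<^esub>" if "g \<in> ?S"
              "\<And>a. a \<in> ?A \<Longrightarrow> g \<otimes>\<^bsub>sym_group n\<^esub> a = a \<otimes>\<^bsub>sym_group n\<^esub> g" for g
              using alt_group_faithful[OF n that] .
            show "\<theta> \<circ> \<psi> \<in> hom (sym_group n) (sym_group n)" "\<psi>' \<circ> \<theta> \<in> hom (sym_group n) (sym_group n)"
              using Group.hom_compose S.auto_hom \<psi> \<psi>' \<theta> by blast+
            show "(\<theta> \<circ> \<psi>) a = (\<psi>' \<circ> \<theta>) a" if "a \<in> ?A" for a
              using \<theta>f[OF that] \<theta>f[OF \<psi>A[OF that]] f\<psi> that AS by auto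
            have "\<theta> ` ?A = ?A" using fA \<theta>f by (metis image_cong)
            then show "(\<theta> \<circ> \<psi>) ` ?A = ?A" using \<psi>A_onto by (simp only: image_comp[symmetric])
          qed
          then show ?thesis using conj_iff \<theta> by auto
        qed
      qed
    next
      case nA: False
      obtain p where p: "p \<in> ?P" "p \<noteq> id" using nontriv by blast
      have n4: "n = 4" using alt_group_subset_normal_subgroup[OF N p] nA by blast
      have nontriv': "\<not> ?P' \<subseteq> {id}"
        using p fP inj_onD[OF f_inj, of p id] PS idS f1 by auto
      have nA': "\<not> ?A \<subseteq> ?P'"
      proof
        assume AP': "?A \<subseteq> ?P'"
        define c :: "nat \<Rightarrow> nat" where "c = cyc 1 2 3"
        have "c \<in> ?P'" using cyc_in_alt_group[of 1 2 3 n] AP' n4 by (auto simp: c_def)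
        then obtain q where q: "q \<in> ?P" "c = f q" using fP by blast
        have "q \<circ> q = id" using displacement_without_alt_group_involutive[OF \<psi> nA q(1)] .
        then have "c \<circ> c = id" using f_mult[OF q(1), of q] q PS f1 by auto
        moreover have "c \<circ> c \<noteq> id" by (simp add: c_def cyc_square_neq_id)
        ultimately show False by blast
      qed
      obtain \<sigma> where \<sigma>: "\<sigma> permutes {1..4}" "\<forall>x\<in>{1..4}. \<sigma> x \<noteq> x" "\<forall>x. \<sigma> (\<sigma> x) = x"
        "\<And>x. x permutes {1..4} \<Longrightarrow> \<psi> x = \<sigma> \<circ> x \<circ> inv' \<sigma>"
        using small_displacement_is_fpf_conjugation[of \<psi>] \<psi> nontriv nA unfolding n4 by blast
      obtain \<tau> where \<tau>: "\<tau> permutes {1..4}" "\<forall>x\<in>{1..4}. \<tau> x \<noteq> x" "\<forall>x. \<tau> (\<tau> x) = x"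
        "\<And>x. x permutes {1..4} \<Longrightarrow> \<psi>' x = \<tau> \<circ> x \<circ> inv' \<tau>"
        using small_displacement_is_fpf_conjugation[of \<psi>'] \<psi>' nontriv' nA' unfolding n4 by blast
      show ?thesis
        using conjugate_if_fpf_conjugations[of \<psi> \<psi>' \<sigma> \<tau>] \<psi> \<psi>' \<sigma> \<tau> unfolding n4 by blast
    qed
  qed
qed

theorem quandle_isomorphic_iff_conjugate:
  assumes "\<psi> \<in> auto (sym_group n)" "\<psi>' \<in> auto (sym_group n)"
  shows "quandle_isomorphic (gen_alexander_quandle (sym_group n) \<psi>) (gen_alexander_quandle (sym_group n) \<psi>') \<longleftrightarrow>
    conjugate_in (AutoGroup (sym_group n)) \<psi> \<psi>'"
  using group.quandle_isomorphic_if_conjugate[OF sym_group_is_group assms]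
    group.quandle_isomorphic_imp_pointed_iso[OF sym_group_is_group assms]
    conjugate_if_pointed_iso[OF assms] by blast

lemma bij_betw_quotients:
  assumes r: "equiv A r" and s: "equiv (q ` A) s"
    and iff: "\<And>x y. x \<in> A \<Longrightarrow> y \<in> A \<Longrightarrow> (q x, q y) \<in> s \<longleftrightarrow> (x, y) \<in> r"
  shows "\<exists>F. bij_betw F (A // r) (q ` A // s) \<and> (\<forall>x\<in>A. F (r `` {x}) = s `` {q x})"
proof -
  define F where "F C = s `` (q ` C)" for C
  have F: "F (r `` {x}) = s `` {q x}" if x: "x \<in> A" for x
  proof -
    have rx: "x \<in> r `` {x}" using equiv_class_self[OF r x] .
    have "s `` {q y} = s `` {q x}" if "y \<in> r `` {x}" for y
    proof -
      have "(x, y) \<in> r" "y \<in> A" using that r by (auto simp: equiv_def)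
      then show ?thesis using equiv_class_eq[OF s, of "q x" "q y"] iff[OF x] by simp
    qed
    then show ?thesis using rx unfolding F_def by blast
  qed
  have "inj_on F (A // r)"
  proof (rule inj_onI)
    fix C D assume "C \<in> A // r" "D \<in> A // r" and eq: "F C = F D"
    then obtain x y where xy: "x \<in> A" "C = r `` {x}" "y \<in> A" "D = r `` {y}" by (auto elim!: quotientE)
    then have "s `` {q x} = s `` {q y}" using F eq by simp
    then have "(q x, q y) \<in> s" using eq_equiv_class[OF _ s, of "q x" "q y"] xy by blast
    then show "C = D" using iff xy equiv_class_eq[OF r] by blast
  qed
  moreover have "F ` (A // r) = q ` A // s"
    using F by (auto simp: quotient_def)
  ultimately show ?thesis using F by (auto simp: bij_betw_def)
qed

theorem corollary1p3:
  fixes n :: nat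
  assumes "n \<ge> 1"
  shows "(\<exists>F. bij_betw F (conjugacy_classes (AutoGroup (sym_group n)))
                         (gen_alexander_classes (sym_group n)) \<and>
              (\<forall>\<psi>\<in>carrier (AutoGroup (sym_group n)).
                 F (conjugacy_rel (AutoGroup (sym_group n)) `` {\<psi>}) =
                 gen_alexander_iso_rel (sym_group n) `` {gen_alexander_quandle (sym_group n) \<psi>})) \<and>
         (\<forall>\<psi>\<in>carrier (AutoGroup (sym_group n)). \<forall>\<psi>'\<in>carrier (AutoGroup (sym_group n)).
            quandle_isomorphic (gen_alexander_quandle (sym_group n) \<psi>)
                               (gen_alexander_quandle (sym_group n) \<psi>') \<longleftrightarrow>
            conjugate_in (AutoGroup (sym_group n)) \<psi> \<psi>')"
proof -
  interpret S: group "sym_group n" by (rule sym_group_is_group)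
  have iff: "quandle_isomorphic (gen_alexander_quandle (sym_group n) \<psi>) (gen_alexander_quandle (sym_group n) \<psi>') \<longleftrightarrow>
      conjugate_in (AutoGroup (sym_group n)) \<psi> \<psi>'"
    if "\<psi> \<in> carrier (AutoGroup (sym_group n))" "\<psi>' \<in> carrier (AutoGroup (sym_group n))" for \<psi> \<psi>'
    using quandle_isomorphic_iff_conjugate that by (simp add: carrier_AutoGroup)
  have "\<exists>F. bij_betw F (conjugacy_classes (AutoGroup (sym_group n))) (gen_alexander_classes (sym_group n)) \<and>
      (\<forall>\<psi>\<in>carrier (AutoGroup (sym_group n)).
         F (conjugacy_rel (AutoGroup (sym_group n)) `` {\<psi>}) =
         gen_alexander_iso_rel (sym_group n) `` {gen_alexander_quandle (sym_group n) \<psi>})"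
    unfolding conjugacy_classes_def gen_alexander_classes_def gen_alexander_quandles_def
  proof (rule bij_betw_quotients[OF group.equiv_conjugacy_rel[OF S.AutoGroup]])
    show "equiv (gen_alexander_quandle (sym_group n) ` carrier (AutoGroup (sym_group n)))
        (gen_alexander_iso_rel (sym_group n))"
      using S.equiv_gen_alexander_iso_rel unfolding gen_alexander_quandles_def .
  qed (auto simp: gen_alexander_iso_rel_def gen_alexander_quandles_def conjugacy_rel_def iff)
  then show ?thesis using iff by blast
qed

end
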